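(* Let $a\in\mathbb{R}$, $b>0$ and $Z\sim\mathrm{AL}(0,a,b)$. Let $h:\mathbb{R}\rightarrow\mathbb{R}$ be a measurable function such that $\mathbb{E}|h(Z)|<\infty$, and write $\tilde{h}(x)=h(x)-\mathbb{E}[h(Z)]$. Then a solution to the initial value problem $$\frac{b^2}{2}f''(x)+af'(x)-f(x)=h(x)-\mathbb{E}[h(Z)],\quad f(0)=0, \qquad ( * )$$ is given by $$f_h(x)=-\frac{1}{\sqrt{2b^2+a^2}}\bigg(\mathrm{e}^{\frac{1}{b}(\sqrt{2+a^2/b^2}-a/b)x}\int_x^\infty \mathrm{e}^{-\frac{1}{b}(\sqrt{2+a^2/b^2}-a/b)t}\tilde{h}(t)\,\mathrm{d}t+\mathrm{e}^{-\frac{1}{b}(\sqrt{2+a^2/b^2}+a/b)x}\int_{-\infty}^x \mathrm{e}^{\frac{1}{b}(\sqrt{2+a^2/b^2}+a/b)t}\tilde{h}(t)\,\mathrm{d}t\bigg).$$ If $h$ is bounded, then $f_h$ is the unique bounded solution to $( * )$, and the following bounds hold: $$\|f_h\|\leq\|\tilde{h}\|,\quad \|f_h'\|\leq\frac{2}{\sqrt{2b^2+a^2}}\|\tilde{h}\|,\quad \|f_h''\|\leq\frac{4}{b^2}\|\tilde{h}\|.$$ Let $k\geq0$ be an integer and now suppose that $h^{(k)}$ is Lipschitz (where $h^{(0)}\equiv h$). Then $$\|f_h^{(k+1)}\|\leq\|h^{(k+1)}\|,\quad \|f_h^{(k+2)}\|\leq\frac{2}{\sqrt{2b^2+a^2}}\|h^{(k+1)}\|,\quad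 \|f_h^{(k+3)}\|\leq\frac{4}{b^2}\|h^{(k+1)}\|.$$
   Context: For $a\in\mathbb{R}$ and $b>0$, $\mathrm{AL}(0,a,b)$ denotes the asymmetric Laplace distribution, with characteristic function $\mathbb{E}[\mathrm{e}^{\mathrm{i}tZ}]=\dfrac{1}{1+b^2t^2/2-\mathrm{i}at}$, equivalently density $\dfrac{1}{\sqrt{2b^2+a^2}}\exp\big(\frac{a}{b^2}x-\frac{1}{b}\sqrt{2+\frac{a^2}{b^2}}\,|x|\big)$, $x\in\mathbb{R}$. For a function $g:\mathbb{R}\to\mathbb{R}$, $\|g\|$ denotes its essential supremum norm on $\mathbb{R}$, so that if $g$ is Lipschitz then $\|g'\|$ is its minimum Lipschitz constant. A solution of $( * )$ is understood as a function $f$ with $f$ and $f'$ locally absolutely continuous satisfying the differential equation almost everywhere. *)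

theory Defs
  imports "HOL-Probability.Probability"
begin

definition AL_density :: "real \<Rightarrow> real \<Rightarrow> real \<Rightarrow> real" where
  "AL_density a b x =
     1 / sqrt (2 * b\<^sup>2 + a\<^sup>2)
       * exp (a / b\<^sup>2 * x - 1 / b * sqrt (2 + a\<^sup>2 / b\<^sup>2) * \<bar>x\<bar>)"

definition AL_distributed :: "'s measure \<Rightarrow> ('s \<Rightarrow> real) \<Rightarrow> real \<Rightarrow> real \<Rightarrow> bool" where
  "AL_distributed M Z a b \<longleftrightarrow> distributed M lborel Z (\<lambda>x. ennreal (AL_density a b x))"

(* Lebesgue measure rather than lborel: esssup is top on non-measurable functions, and a derivative
   that exists only almost everywhere need only be Lebesgue measurable.  The values of deriv at
   points of non-differentiability are irrelevant when these form a null set. *)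
definition ess_norm :: "(real \<Rightarrow> real) \<Rightarrow> ereal" where
  "ess_norm g = esssup lebesgue (\<lambda>x. ereal \<bar>g x\<bar>)"

(* The library's absolutely_continuous is about measures.  A pair (x, y) in S encodes the interval
   with endpoints x < y. *)
definition abs_cont_on_interval :: "real \<Rightarrow> real \<Rightarrow> (real \<Rightarrow> real) \<Rightarrow> bool" where
  "abs_cont_on_interval c d f \<longleftrightarrow>
     (\<forall>\<epsilon>>0. \<exists>\<delta>>0. \<forall>S :: (real \<times> real) set.
        finite S \<and> (\<forall>(x, y)\<in>S. c \<le> x \<and> x < y \<and> y \<le> d) \<and>
        disjoint_family_on (\<lambda>(x, y). {x<..<y}) S \<and>
        (\<Sum>(x, y)\<in>S. y - x) < \<delta>
        \<longrightarrow> (\<Sum>(x, y)\<in>S. \<bar>f y - f x\<bar>) < \<epsilon>)"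

definition loc_abs_cont :: "(real \<Rightarrow> real) \<Rightarrow> bool" where
  "loc_abs_cont f \<longleftrightarrow> (\<forall>c d. c \<le> d \<longrightarrow> abs_cont_on_interval c d f)"

definition stein_ivp_solution ::
    "real \<Rightarrow> real \<Rightarrow> (real \<Rightarrow> real) \<Rightarrow> (real \<Rightarrow> real) \<Rightarrow> bool" where
  "stein_ivp_solution a b r f \<longleftrightarrow>
     (\<forall>x. f differentiable (at x)) \<and> loc_abs_cont f \<and> loc_abs_cont (deriv f) \<and>
     (AE x in lebesgue. deriv f differentiable (at x) \<and>
        b\<^sup>2 / 2 * deriv (deriv f) x + a * deriv f x - f x = r x) \<and>
     f 0 = 0"

definition rate_pos :: "real \<Rightarrow> real \<Rightarrow> real" where
  "rate_pos a b = 1 / b * (sqrt (2 + a\<^sup>2 / b\<^sup>2) - a / b)"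

definition rate_neg :: "real \<Rightarrow> real \<Rightarrow> real" where
  "rate_neg a b = 1 / b * (sqrt (2 + a\<^sup>2 / b\<^sup>2) + a / b)"

definition stein_sol :: "real \<Rightarrow> real \<Rightarrow> (real \<Rightarrow> real) \<Rightarrow> real \<Rightarrow> real" where
  "stein_sol a b r x =
     - (1 / sqrt (2 * b\<^sup>2 + a\<^sup>2)) *
       (exp (rate_pos a b * x) * (LBINT t:{x..}. exp (- rate_pos a b * t) * r t)
        + exp (- rate_neg a b * x) * (LBINT t:{..x}. exp (rate_neg a b * t) * r t))"

end

theory Submission
  imports Defs "HOL-Real_Asymp.Real_Asymp"
begin

text \<open>Put \<open>p = rate_pos a b\<close>, \<open>q = rate_neg a b\<close> and \<open>r = h - E h(Z)\<close>. Then \<open>p q = 2/b\<^sup>2\<close>, \<open>q - p = 2a/b\<^sup>2\<close> and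
\<open>p q/(p + q) = 1/sqrt (2 b\<^sup>2 + a\<^sup>2)\<close>, so that after multiplication by \<open>2/b\<^sup>2\<close> the Stein equation reads
\<open>f'' + (q - p) f' - p q f = p q r\<close>, and its characteristic polynomial factors as \<open>(D - p)(D + q)\<close>.
The function \<open>stein_sol\<close> is \<open>- p q/(p + q) (R + L)\<close>, where \<open>R = (p - D)\<^sup>-\<^sup>1 r\<close> and \<open>L = (q + D)\<^sup>-\<^sup>1 r\<close>
integrate \<open>r\<close> over the half-lines to the right and to the left of \<open>x\<close> against exponential weights: \<open>R' = p R - r\<close> and
\<open>L' = r - q L\<close> almost everywhere. In the first derivative of \<open>R + L\<close> the two terms in \<open>r\<close> cancel, which is why
\<open>f\<close> is continuously differentiable although \<open>r\<close> is only measurable. The initial value is \<open>f 0 = - E r(Z) = 0\<close>,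
since the weights of \<open>R\<close> and \<open>L\<close> at \<open>0\<close> make up the density of \<open>Z\<close> up to normalisation. A difference of two bounded
solutions is a bounded combination of \<open>exp (p x)\<close> and \<open>exp (- q x)\<close>, hence zero.

All bounds rest on two properties of the resolvents. Since the weights have masses \<open>1/p\<close> and \<open>1/q\<close>,
\<open>\<bar>r\<bar> \<le> K\<close> implies \<open>\<bar>R\<bar> \<le> K/p\<close> and \<open>\<bar>L\<bar> \<le> K/q\<close>; since the resolvents commute with translations, the same
inequalities hold for the Lipschitz constants. As \<open>f\<close>, \<open>f'\<close> and \<open>f''\<close> are linear combinations of \<open>r\<close>, \<open>R\<close>
and \<open>L\<close> with explicit coefficients, both families of inequalities follow, with constants \<open>1\<close>,
\<open>2 p q/(p + q)\<close> and \<open>2 p q\<close> (lemmas \<open>green_bounds\<close> and \<open>green_lipschitz\<close>). For \<open>k > 0\<close>, integration by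
parts shows that the solution operator commutes with differentiation on functions of subexponential growth,
which reduces the claim to the Lipschitz function \<open>h\<^sup>(\<^sup>k\<^sup>)\<close>.

The passage between essential suprema of derivatives and Lipschitz constants, and the meaning of a
solution, require real analysis of absolutely continuous functions: an absolutely continuous function is
the integral of its derivative (\<open>AE_derivative_has_integral\<close>), an indefinite integral is absolutely
continuous and has the integrand as its derivative almost everywhere
(\<open>is_indefinite_integral_loc_abs_cont\<close>, \<open>is_indefinite_integral_AE_derivative\<close>), and a Lipschitz function is
differentiable almost everywhere (\<open>lipschitz_AE_differentiable\<close>).\<close>

section \<open>The fundamental theorem for absolutely continuous functions\<close>

lemma abs_cont_on_intervalE:
  assumes "abs_cont_on_interval c d f" "\<epsilon> > 0"
  obtains \<delta> where "\<delta> > 0"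
    "\<And>S. finite S \<Longrightarrow> (\<forall>(x, y)\<in>S. c \<le> x \<and> x < y \<and> y \<le> d) \<Longrightarrow>
        disjoint_family_on (\<lambda>(x, y). {x<..<y}) S \<Longrightarrow> (\<Sum>(x, y)\<in>S. y - x) < \<delta> \<Longrightarrow>
        (\<Sum>(x, y)\<in>S. \<bar>f y - f x\<bar>) < \<epsilon>"
proof -
  from assms(1)[unfolded abs_cont_on_interval_def, THEN spec, THEN mp, OF assms(2)]
  show ?thesis by (elim exE conjE) (rule that, assumption, iprover)
qed

text \<open>A direct comparison of \<open>f d - f c\<close> with Henstock--Kurzweil sums. At a point of differentiability the gauge makes the
increment of \<open>f\<close> over a tagged interval agree with \<open>g\<close> times its length up to a small multiple of that length.
At the exceptional points the gauge forces the intervals into an open set of small measure, where absolute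
continuity makes the sum of the increments small.\<close>

lemma AE_derivative_has_integral:
  assumes "c \<le> d" and ac: "abs_cont_on_interval c d f"
    and der: "AE x in lebesgue. (f has_real_derivative g x) (at x)"
  shows "(g has_integral (f d - f c)) {c..d}"
proof -
  obtain N where N: "negligible N" "\<And>x. x \<notin> N \<Longrightarrow> (f has_real_derivative g x) (at x)"
    using der unfolding eventually_ae_filter_negligible by auto
  \<comment> \<open>Changing the integrand to zero on the null set removes the exceptional tags from the Riemann sums.\<close>
  define g0 where "g0 x = (if x \<in> N then 0 else g x)" for x
  have "(g0 has_integral (f d - f c)) (cbox c d)"
    unfolding has_integral
  proof (intro allI impI)
    fix e :: real assume "e > 0"
    define \<eta> where "\<eta> = e / (2 * (d - c + 1))"
    have "\<eta> > 0" using \<open>e > 0\<close> \<open>c \<le> d\<close> by (auto simp: \<eta>_def)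
    obtain \<delta> where "\<delta> > 0" and \<delta>: "\<And>S. finite S \<Longrightarrow> (\<forall>(x, y)\<in>S. c \<le> x \<and> x < y \<and> y \<le> d) \<Longrightarrow>
        disjoint_family_on (\<lambda>(x, y). {x<..<y}) S \<Longrightarrow> (\<Sum>(x, y)\<in>S. y - x) < \<delta> \<Longrightarrow>
        (\<Sum>(x, y)\<in>S. \<bar>f y - f x\<bar>) < e / 2"
      by (rule abs_cont_on_intervalE[OF ac, of "e / 2"]) (use \<open>e > 0\<close> in simp, blast)
    obtain U where U: "open U" "N \<subseteq> U" "U \<in> lmeasurable" "measure lebesgue U < \<delta>"
    proof -
      have "N \<in> sets lebesgue" using N(1) negligible_imp_sets by blast
      then obtain U where U: "open U" "N \<subseteq> U" "U - N \<in> lmeasurable" "emeasure lebesgue (U - N) < ennreal \<delta>"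
        using sets_lebesgue_outer_open \<open>\<delta> > 0\<close> by metis
      have eq: "U = (U - N) \<union> N" using U by auto
      have "measure lebesgue U = measure lebesgue (U - N)"
        using N(1) by (metis eq measure_Un_null_set negligible_iff_null_sets U(3) fmeasurableD)
      moreover have "measure lebesgue (U - N) < \<delta>"
        using U(3,4) \<open>\<delta> > 0\<close> by (metis emeasure_eq_measure2 ennreal_less_iff measure_nonneg)
      moreover have "U \<in> lmeasurable"
        using U(3) N(1) eq by (metis fmeasurable.Un negligible_imp_measurable)
      ultimately show ?thesis using U that by auto
    qed
    have "\<exists>r>0. \<forall>y. \<bar>y - x\<bar> < r \<longrightarrow> \<bar>f y - f x - g x * (y - x)\<bar> \<le> \<eta> * \<bar>y - x\<bar>" if "x \<notin> N" for x
      using N(2)[OF that] \<open>\<eta> > 0\<close>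
      unfolding has_field_derivative_def has_derivative_at_alt by (simp add: mult.commute)
    then obtain r where r: "\<And>x. x \<notin> N \<Longrightarrow> r x > 0"
        "\<And>x y. x \<notin> N \<Longrightarrow> \<bar>y - x\<bar> < r x \<Longrightarrow> \<bar>f y - f x - g x * (y - x)\<bar> \<le> \<eta> * \<bar>y - x\<bar>"
      by metis
    define \<gamma> where "\<gamma> x = (if x \<in> N then U else ball x (r x))" for x
    have gauge: "gauge \<gamma>"
      using U r unfolding gauge_def \<gamma>_def by auto
    have approx: "norm ((\<Sum>(x, k)\<in>D. measure lborel k *\<^sub>R g0 x) - (f d - f c)) < e"
      if D: "D tagged_division_of cbox c d" "\<gamma> fine D" for D
    proof -
      have fin: "finite D" using tagged_division_ofD(1)[OF D(1)] .
      have k: "k = {Inf k..Sup k} \<and> Inf k \<le> x \<and> x \<le> Sup k \<and> c \<le> Inf k \<and> Sup k \<le> d \<and> measure lborel k = Sup k - Inf k \<and> k \<subseteq> \<gamma> x"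
        if xk: "(x, k) \<in> D" for x k
      proof -
        obtain u v where uv: "k = cbox u v" using tagged_division_ofD(4)[OF D(1) xk] by metis
        moreover have "x \<in> k" "k \<subseteq> {c..d}"
          using tagged_division_ofD(2,3)[OF D(1) xk] by (auto simp: cbox_interval)
        moreover have "k \<subseteq> \<gamma> x" using D(2) xk unfolding fine_def by auto
        ultimately show ?thesis by (auto simp: cbox_interval)
      qed
      \<comment> \<open>The exceptional tagged intervals. Degenerate ones contribute nothing and are dropped, so that distinct elements have distinct, disjoint interiors.\<close>
      define B where "B = {(x, k) \<in> D. x \<in> N \<and> Inf k < Sup k}"
      have finB: "finite B" using fin by (auto simp: B_def intro: finite_subset)
      have disj: "{Inf k<..<Sup k} \<inter> {Inf k'<..<Sup k'} = {}"
        if "(x, k) \<in> D" "(x', k') \<in> D" "(x, k) \<noteq> (x', k')" for x k x' k'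
        using tagged_division_ofD(5)[OF D(1) that] k[OF that(1)] k[OF that(2)] interior_atLeastAtMost_real by metis
      define S where "S = (\<lambda>(x, k). (Inf k, Sup k)) ` B"
      have inj: "inj_on (\<lambda>(x, k). (Inf k, Sup k)) B"
      proof (rule inj_onI, clarify)
        fix x k x' k' assume *: "(x, k) \<in> B" "(x', k') \<in> B" "Inf k = Inf k'" "Sup k = Sup k'"
        have "Inf k < Sup k" using * by (auto simp: B_def)
        then have "{Inf k<..<Sup k} \<noteq> {}" by simp
        then show "x = x' \<and> k = k'" using disj[of x k x' k'] * by (auto simp: B_def)
      qed
      have S: "finite S" "\<forall>(x, y)\<in>S. c \<le> x \<and> x < y \<and> y \<le> d"
        using finB k by (auto simp: S_def B_def)
      have Sd: "disjoint_family_on (\<lambda>(x, y). {x<..<y}) S"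
        unfolding disjoint_family_on_def
      proof (intro ballI impI)
        fix i j assume "i \<in> S" "j \<in> S" "i \<noteq> j"
        then obtain x k x' k' where "(x, k) \<in> D" "(x', k') \<in> D" "i = (Inf k, Sup k)" "j = (Inf k', Sup k')"
          by (auto simp: S_def B_def)
        with disj[of x k x' k'] \<open>i \<noteq> j\<close>
        show "(case i of (x, y) \<Rightarrow> {x<..<y}) \<inter> (case j of (x, y) \<Rightarrow> {x<..<y}) = {}" by auto
      qed
      have fin_Ioo: "emeasure lborel {x<..<y} \<noteq> \<top>" for x y :: real
        by (cases "x \<le> y") auto
      have "(\<Sum>(x, y)\<in>S. y - x) = (\<Sum>i\<in>S. measure lebesgue (case i of (x, y) \<Rightarrow> {x<..<y}))"
        using S by (intro sum.cong) auto
      also have "\<dots> = measure lebesgue (\<Union>i\<in>S. case i of (x, y) \<Rightarrow> {x<..<y})"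
        by (intro measure_finite_Union[symmetric] S Sd) (auto split: prod.splits simp: fin_Ioo)
      also have "\<dots> \<le> measure lebesgue U"
      proof (rule measure_mono_fmeasurable)
        show "(\<Union>i\<in>S. case i of (x, y) \<Rightarrow> {x<..<y}) \<subseteq> U"
          using k unfolding S_def B_def \<gamma>_def by force
        show "(\<Union>i\<in>S. case i of (x, y) \<Rightarrow> {x<..<y}) \<in> sets lebesgue"
          using S by (intro sets.finite_UN) (auto split: prod.splits)
      qed (use U in auto)
      finally have "(\<Sum>(x, y)\<in>S. y - x) < \<delta>" using U by simp
      from \<delta>[OF S Sd this] have "(\<Sum>(x, y)\<in>S. \<bar>f y - f x\<bar>) < e / 2" .
      also have "(\<Sum>(x, y)\<in>S. \<bar>f y - f x\<bar>) = (\<Sum>(x, k)\<in>B. \<bar>f (Sup k) - f (Inf k)\<bar>)"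
        unfolding S_def by (subst sum.reindex[OF inj]) (auto intro!: sum.cong)
      finally have bad: "(\<Sum>(x, k)\<in>B. \<bar>f (Sup k) - f (Inf k)\<bar>) < e / 2" .
      have pt: "\<bar>measure lborel k * g0 x - (f (Sup k) - f (Inf k))\<bar> \<le>
          \<eta> * measure lborel k + (if x \<in> N \<and> Inf k < Sup k then \<bar>f (Sup k) - f (Inf k)\<bar> else 0)"
        if "(x, k) \<in> D" for x k
      proof (cases "x \<in> N")
        case True
        then show ?thesis using k[OF that] \<open>\<eta> > 0\<close>
          by (cases "Inf k = Sup k") (auto simp: g0_def abs_minus_commute)
      next
        case False
        let ?u = "Inf k" and ?v = "Sup k"
        have kk: "?u \<le> x" "x \<le> ?v" "measure lborel k = ?v - ?u" using k[OF that] by auto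
        have "?u \<in> k" "?v \<in> k" using k[OF that] kk by (metis atLeastAtMost_iff order.refl order.trans)+
        then have "\<bar>?u - x\<bar> < r x" "\<bar>?v - x\<bar> < r x"
          using k[OF that] False unfolding \<gamma>_def by (auto simp: dist_real_def)
        with r(2)[OF False] have "\<bar>f ?u - f x - g x * (?u - x)\<bar> \<le> \<eta> * \<bar>?u - x\<bar>"
          "\<bar>f ?v - f x - g x * (?v - x)\<bar> \<le> \<eta> * \<bar>?v - x\<bar>" by auto
        moreover have "measure lborel k * g0 x - (f ?v - f ?u) =
            (f ?u - f x - g x * (?u - x)) - (f ?v - f x - g x * (?v - x))"
          unfolding kk(3) using False by (simp add: g0_def algebra_simps)
        moreover have "\<eta> * \<bar>?u - x\<bar> + \<eta> * \<bar>?v - x\<bar> = \<eta> * measure lborel k"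
          unfolding kk(3) using kk(1,2) by (simp add: algebra_simps)
        ultimately show ?thesis using False by simp
      qed
      have "(\<Sum>(x, k)\<in>D. measure lborel k *\<^sub>R g0 x) - (f d - f c) =
          (\<Sum>(x, k)\<in>D. measure lborel k * g0 x - (f (Sup k) - f (Inf k)))"
        using additive_tagged_division_1[OF \<open>c \<le> d\<close>, of D f] D(1)
        by (simp add: sum_subtractf split_def cbox_interval)
      also have "\<bar>\<dots>\<bar> \<le> (\<Sum>(x, k)\<in>D. \<bar>measure lborel k * g0 x - (f (Sup k) - f (Inf k))\<bar>)"
        by (rule order_trans[OF sum_abs]) (simp add: split_def)
      also have "\<dots> \<le> (\<Sum>(x, k)\<in>D. \<eta> * measure lborel k + (if x \<in> N \<and> Inf k < Sup k then \<bar>f (Sup k) - f (Inf k)\<bar> else 0))"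
        by (rule sum_mono) (clarify, rule pt)
      also have "\<dots> = \<eta> * (\<Sum>(x, k)\<in>D. measure lborel k) + (\<Sum>(x, k)\<in>D. if x \<in> N \<and> Inf k < Sup k then \<bar>f (Sup k) - f (Inf k)\<bar> else 0)"
        by (simp add: split_def sum.distrib sum_distrib_left)
      also have "(\<Sum>(x, k)\<in>D. measure lborel k) = d - c"
        using additive_content_tagged_division[OF D(1)] \<open>c \<le> d\<close> by (simp add: content_real cbox_interval)
      also have "(\<Sum>(x, k)\<in>D. if x \<in> N \<and> Inf k < Sup k then \<bar>f (Sup k) - f (Inf k)\<bar> else 0)
          = (\<Sum>(x, k)\<in>B. \<bar>f (Sup k) - f (Inf k)\<bar>)"
        unfolding B_def using fin
        by (intro sum.mono_neutral_cong_right) (auto split: prod.splits)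
      also have "\<eta> * (d - c) \<le> e / 2"
        using \<open>e > 0\<close> \<open>c \<le> d\<close> by (auto simp: \<eta>_def field_simps)
      finally show ?thesis using bad by simp
    qed
    show "\<exists>\<gamma>. gauge \<gamma> \<and> (\<forall>\<D>. \<D> tagged_division_of cbox c d \<and> \<gamma> fine \<D> \<longrightarrow>
        norm ((\<Sum>(x, k)\<in>\<D>. measure lborel k *\<^sub>R g0 x) - (f d - f c)) < e)"
      by (intro exI[of _ \<gamma>] conjI allI impI gauge) (elim conjE, rule approx)
  qed
  then show ?thesis
    unfolding cbox_interval by (rule has_integral_spike[OF N(1), rotated]) (simp add: g0_def)
qed

section \<open>Lebesgue differentiation of indefinite integrals\<close>

text \<open>Lebesgue's differentiation theorem on the line. At an exceptional point \<open>x\<close> there are arbitrarily short intervals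
with one endpoint \<open>x\<close> whose increment differs from \<open>f x\<close> times their length by at least a fixed proportion of
the length. Vitali's covering theorem selects disjoint ones among them that cover almost all exceptional
points; being fine tagged intervals, they have small total length by Henstock's lemma.\<close>

lemma integral_real_derivative_AE:
  fixes f :: "real \<Rightarrow> real"
  assumes f: "f integrable_on {c..d}"
  shows "negligible {x \<in> {c<..<d}. \<not> ((\<lambda>y. integral {c..y} f) has_real_derivative f x) (at x)}"
proof -
  define F where "F y = integral {c..y} f" for y
  define bad where "bad n x y \<longleftrightarrow> y \<noteq> x \<and> \<bar>F y - F x - f x * (y - x)\<bar> > \<bar>y - x\<bar> / real (Suc n)" for n x y
  define S where "S n = {x \<in> {c<..<d}. \<forall>\<delta>>0. \<exists>y\<in>{c<..<d}. \<bar>y - x\<bar> < \<delta> \<and> bad n x y}" for n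
  have Fdiff: "integral {min x y..max x y} f = sgn (y - x) * (F y - F x)"
    if "x \<in> {c<..<d}" "y \<in> {c<..<d}" for x y
  proof -
    have *: "F v - F u = integral {u..v} f" if "u \<le> v" "u \<in> {c<..<d}" "v \<in> {c<..<d}" for u v
    proof -
      have "f integrable_on {c..v}" using f that by (auto intro: integrable_on_subinterval)
      from Henstock_Kurzweil_Integration.integral_combine[OF _ _ this, of u] that
      show ?thesis by (auto simp: F_def)
    qed
    show ?thesis using *[of x y] *[of y x] that by (auto simp: min_def max_def sgn_if)
  qed
  have "negligible (S n)" for n
    unfolding negligible_outer_le
  proof (intro allI impI)
    fix e :: real assume "e > 0"
    then have e_n: "e / real (Suc n) > 0" by simp
    have fc: "f integrable_on cbox c d" using f by (simp add: cbox_interval)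
    obtain \<gamma> where \<gamma>: "gauge \<gamma>"
      "\<And>p. p tagged_partial_division_of cbox c d \<Longrightarrow> \<gamma> fine p \<Longrightarrow>
           (\<Sum>(x, k)\<in>p. norm (measure lborel k *\<^sub>R f x - integral k f)) < e / real (Suc n)"
      by (rule Henstock_lemma[OF fc e_n]) (rule that)
    \<comment> \<open>The interval between \<open>x\<close> and \<open>y\<close>, in whichever order, with its centre and radius as needed for the covering theorem.\<close>
    define I where "I = (\<lambda>(x::real, y). {min x y..max x y})"
    define a where "a = (\<lambda>(x::real, y). (x + y) / 2)"
    define r where "r = (\<lambda>(x::real, y). \<bar>y - x\<bar> / 2)"
    have Icball: "cball (a i) (r i) = I i" for i
      by (cases i) (auto simp: I_def a_def r_def dist_real_def min_def max_def abs_if field_simps split: if_splits)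
    define K where "K = {(x, y). x \<in> {c<..<d} \<and> y \<in> {c<..<d} \<and> bad n x y \<and> I (x, y) \<subseteq> \<gamma> x}"
    have cover: "\<exists>i. i \<in> K \<and> x \<in> cball (a i) (r i) \<and> r i < \<delta>" if xS: "x \<in> S n" and "\<delta> > 0" for x \<delta>
    proof -
      have "x \<in> \<gamma> x" "open (\<gamma> x)" using \<gamma>(1) by (auto simp: gauge_def)
      then obtain \<rho> where \<rho>: "\<rho> > 0" "ball x \<rho> \<subseteq> \<gamma> x" by (meson openE)
      then have "min \<rho> \<delta> > 0" using \<open>\<delta> > 0\<close> by auto
      then obtain y where y: "y \<in> {c<..<d}" "\<bar>y - x\<bar> < min \<rho> \<delta>" "bad n x y"
        using xS unfolding S_def by blast
      have "I (x, y) \<subseteq> ball x \<rho>" using y by (auto simp: I_def dist_real_def)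
      then have "(x, y) \<in> K" using y \<rho> xS by (auto simp: K_def S_def)
      moreover have "x \<in> cball (a (x, y)) (r (x, y))" by (simp only: Icball) (simp add: I_def)
      moreover have "r (x, y) < \<delta>" using y by (auto simp: r_def)
      ultimately show ?thesis by blast
    qed
    have r_pos: "0 < r i" if "i \<in> K" for i
      using that by (auto simp: K_def r_def bad_def)
    obtain C where C: "countable C" "C \<subseteq> K"
      "pairwise (\<lambda>i j. disjnt (cball (a i) (r i)) (cball (a j) (r j))) C"
      "negligible (S n - (\<Union>i\<in>C. cball (a i) (r i)))"
      by (rule Vitali_covering_theorem_cballs[of K r "S n" a, OF r_pos cover]) (assumption | rule that)+
    note C = C[unfolded Icball]
    have bound: "measure lebesgue (\<Union>i\<in>C'. I i) \<le> e" if C': "C' \<subseteq> C" "finite C'" for C'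
    proof -
      have K: "x \<in> {c<..<d}" "y \<in> {c<..<d}" "bad n x y" "I (x, y) \<subseteq> \<gamma> x" if "(x, y) \<in> C'" for x y
        using that C' C(2) by (auto simp: K_def)
      have dis: "I i \<inter> I j = {}" if "i \<in> C'" "j \<in> C'" "i \<noteq> j" for i j
        using C(3) C' that by (auto simp: pairwise_def disjnt_def)
      have ne: "fst i \<in> I i" for i by (cases i) (auto simp: I_def)
      define p where "p = (\<lambda>i. (fst i, I i)) ` C'"
      have inj: "inj_on (\<lambda>i. (fst i, I i)) C'"
        using dis ne by (intro inj_onI) (metis IntI empty_iff prod.inject)
      have "p tagged_partial_division_of cbox c d"
        unfolding tagged_partial_division_of_def
      proof (intro conjI allI impI)
        show "finite p" using C' by (simp add: p_def)
        fix x k assume "(x, k) \<in> p"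
        then obtain y where xy: "(x, y) \<in> C'" "k = I (x, y)" by (auto simp: p_def)
        show "x \<in> k" using xy by (auto simp: I_def)
        show "k \<subseteq> cbox c d" using xy K[OF xy(1)] by (auto simp: I_def)
        show "\<exists>a b. k = cbox a b" using xy by (auto simp: I_def cbox_interval)
      next
        fix x k x' k' assume *: "(x, k) \<in> p \<and> (x', k') \<in> p \<and> (x, k) \<noteq> (x', k')"
        then obtain i j where "i \<in> C'" "j \<in> C'" "i \<noteq> j" "k = I i" "k' = I j"
          unfolding p_def by auto
        then show "interior k \<inter> interior k' = {}"
          using dis interior_subset by (metis disjoint_iff subset_iff)
      qed
      moreover have "\<gamma> fine p" using K(4) unfolding fine_def p_def by fastforce
      ultimately have "(\<Sum>(x, k)\<in>p. norm (measure lborel k *\<^sub>R f x - integral k f)) < e / real (Suc n)"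
        by (rule \<gamma>(2))
      moreover have "(\<Sum>(x, k)\<in>p. norm (measure lborel k *\<^sub>R f x - integral k f)) =
          (\<Sum>i\<in>C'. norm (measure lborel (I i) *\<^sub>R f (fst i) - integral (I i) f))"
        unfolding p_def by (subst sum.reindex[OF inj]) simp
      moreover have "(\<Sum>i\<in>C'. \<bar>snd i - fst i\<bar> / real (Suc n)) \<le>
          (\<Sum>i\<in>C'. norm (measure lborel (I i) *\<^sub>R f (fst i) - integral (I i) f))"
      proof (rule sum_mono)
        fix i assume "i \<in> C'"
        obtain x y where i: "i = (x, y)" by (cases i)
        note Kxy = K[of x y] \<open>i \<in> C'\<close>[unfolded i]
        have "measure lborel (I i) *\<^sub>R f (fst i) - integral (I i) f =
            - sgn (y - x) * (F y - F x - f x * (y - x))"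
          using Fdiff[of x y] Kxy by (auto simp: I_def i bad_def sgn_if min_def max_def algebra_simps)
        moreover have "\<bar>sgn (y - x)\<bar> = 1" using Kxy by (auto simp: bad_def sgn_if)
        ultimately have "norm (measure lborel (I i) *\<^sub>R f (fst i) - integral (I i) f) =
            \<bar>F y - F x - f x * (y - x)\<bar>" by (simp add: abs_mult)
        then show "\<bar>snd i - fst i\<bar> / real (Suc n) \<le>
            norm (measure lborel (I i) *\<^sub>R f (fst i) - integral (I i) f)"
          using Kxy unfolding bad_def i by simp
      qed
      ultimately have "(\<Sum>i\<in>C'. \<bar>snd i - fst i\<bar>) / real (Suc n) < e / real (Suc n)"
        by (simp add: sum_divide_distrib)
      then have "(\<Sum>i\<in>C'. \<bar>snd i - fst i\<bar>) < e" by (simp add: divide_less_cancel)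
      moreover have "measure lebesgue (\<Union>i\<in>C'. I i) \<le> (\<Sum>i\<in>C'. measure lebesgue (I i))"
        using C' by (intro measure_UNION_le) (auto simp: I_def)
      moreover have "measure lebesgue (I i) = \<bar>snd i - fst i\<bar>" for i
        by (cases i) (auto simp: I_def min_def max_def)
      ultimately show ?thesis by simp
    qed
    have I_meas: "I i \<in> lmeasurable" for i by (cases i) (auto simp: I_def)
    have "(\<Union>i\<in>C. I i) \<in> lmeasurable" "measure lebesgue (\<Union>i\<in>C. I i) \<le> e"
      using fmeasurable_UN_bound[OF C(1), of I lebesgue e] measure_UN_bound[OF C(1), of I lebesgue e]
        I_meas bound by auto
    moreover define N where "N = S n - (\<Union>i\<in>C. I i)"
    moreover have "negligible N" using C(4) by (simp add: N_def)
    ultimately have "(\<Union>i\<in>C. I i) \<union> N \<in> lmeasurable" "measure lebesgue ((\<Union>i\<in>C. I i) \<union> N) \<le> e"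
      using measure_Un_null_set[of "\<Union>i\<in>C. I i" lebesgue N] fmeasurable.Un[of "\<Union>i\<in>C. I i" lebesgue N]
        negligible_imp_measurable[of N] negligible_iff_null_sets[of N] fmeasurableD[of "\<Union>i\<in>C. I i" lebesgue]
      by auto
    then show "\<exists>T. S n \<subseteq> T \<and> T \<in> lmeasurable \<and> measure lebesgue T \<le> e"
      by (intro exI[of _ "(\<Union>i\<in>C. I i) \<union> N"]) (auto simp: N_def)
  qed
  then have "negligible (\<Union>n. S n)" by (intro negligible_Union_nat)
  moreover have "(F has_real_derivative f x) (at x)" if x: "x \<in> {c<..<d}" "\<And>n. x \<notin> S n" for x
    unfolding has_field_derivative_def has_derivative_at_alt
  proof (intro conjI allI impI)
    fix e :: real assume "e > 0"
    then obtain n where n: "1 / real (Suc n) < e" using nat_approx_posE by blast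
    obtain \<delta> where \<delta>: "\<delta> > 0" "\<And>y. y \<in> {c<..<d} \<Longrightarrow> \<bar>y - x\<bar> < \<delta> \<Longrightarrow> \<not> bad n x y"
      using x unfolding S_def by blast
    show "\<exists>d>0. \<forall>y. norm (y - x) < d \<longrightarrow> norm (F y - F x - f x * (y - x)) \<le> e * norm (y - x)"
    proof (intro exI conjI allI impI)
      show "min \<delta> (min (x - c) (d - x)) > 0" using x \<delta> by auto
      fix y assume y: "norm (y - x) < min \<delta> (min (x - c) (d - x))"
      then have "\<not> bad n x y" using \<delta>(2)[of y] by (auto simp: abs_if split: if_splits)
      then have "\<bar>F y - F x - f x * (y - x)\<bar> \<le> \<bar>y - x\<bar> / real (Suc n)"
        by (cases "y = x") (auto simp: bad_def)
      also have "\<dots> = 1 / real (Suc n) * \<bar>y - x\<bar>" by simp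
      also have "\<dots> \<le> e * \<bar>y - x\<bar>" using n by (intro mult_right_mono) auto
      finally show "norm (F y - F x - f x * (y - x)) \<le> e * norm (y - x)" by simp
    qed
  qed (rule bounded_linear_mult_right)
  ultimately show ?thesis
    unfolding F_def by (elim negligible_subset) blast
qed

text \<open>Stated for increments over compact intervals, so that no base point is singled out and the integrand need only be
locally integrable.\<close>

definition is_indefinite_integral :: "(real \<Rightarrow> real) \<Rightarrow> (real \<Rightarrow> real) \<Rightarrow> bool" where
  "is_indefinite_integral F g \<longleftrightarrow>
     (\<forall>c d. c \<le> d \<longrightarrow> set_integrable lborel {c..d} g \<and> F d - F c = (LBINT x:{c..d}. g x))"

lemma is_indefinite_integralD:
  assumes "is_indefinite_integral F g" "c \<le> d"
  shows "set_integrable lborel {c..d} g" "(LBINT x:{c..d}. g x) = F d - F c"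
    "(g has_integral (F d - F c)) {c..d}"
proof -
  show *: "set_integrable lborel {c..d} g" "(LBINT x:{c..d}. g x) = F d - F c"
    using assms by (auto simp: is_indefinite_integral_def)
  show "(g has_integral (F d - F c)) {c..d}"
    using set_borel_integral_eq_integral[OF *(1)] *(2) by (metis integrable_integral)
qed

text \<open>The interval version is applied on each interval from \<open>-n\<close> to \<open>n\<close>; countably many null sets arise.\<close>

lemma is_indefinite_integral_AE_derivative:
  assumes F: "is_indefinite_integral F g"
  shows "AE x in lebesgue. (F has_real_derivative g x) (at x)"
proof -
  define B where "B n = {x \<in> {- real n<..<real n}.
    \<not> ((\<lambda>y. integral {- real n..y} g) has_real_derivative g x) (at x)}" for n
  have "negligible (B n)" for n
    unfolding B_def using is_indefinite_integralD(3)[OF F, of "- real n" "real n"]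
    by (intro integral_real_derivative_AE) auto
  then have "negligible (\<Union>n. B n)" by (intro negligible_Union_nat)
  moreover have "(F has_real_derivative g x) (at x)" if "\<And>n. x \<notin> B n" for x
  proof -
    obtain n where n: "\<bar>x\<bar> < real n" using reals_Archimedean2 by blast
    then have x: "x \<in> {- real n<..<real n}" by auto
    have "((\<lambda>y. integral {- real n..y} g) has_real_derivative g x) (at x)"
      using that[of n] x by (auto simp: B_def)
    then have "((\<lambda>y. integral {- real n..y} g + F (- real n)) has_real_derivative g x) (at x)"
      by (auto intro!: derivative_eq_intros)
    then show ?thesis
    proof (rule has_field_derivative_transform_within_open[of _ _ _ "{- real n<..<real n}"])
      fix y assume "y \<in> {- real n<..<real n}"
      then show "integral {- real n..y} g + F (- real n) = F y"
        using is_indefinite_integralD(3)[OF F, of "- real n" y] by (simp add: integral_unique)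
    qed (use x in auto)
  qed
  ultimately show ?thesis
    unfolding eventually_ae_filter_negligible by blast
qed

text \<open>The integrand splits into a bounded part, whose integral over a family of intervals is at most a multiple of their
total length, and the excess over a high truncation level, whose integral over \<open>{c..d}\<close> is small by dominated
convergence.\<close>

lemma is_indefinite_integral_loc_abs_cont:
  assumes F: "is_indefinite_integral F g"
  shows "loc_abs_cont F"
  unfolding loc_abs_cont_def abs_cont_on_interval_def
proof (intro allI impI)
  fix c d \<epsilon> :: real assume "c \<le> d" "\<epsilon> > 0"
  have int_g: "set_integrable lborel {c..d} g" using is_indefinite_integralD(1)[OF F \<open>c \<le> d\<close>] .
  define G where "G x = indicator {c..d} x * \<bar>g x\<bar>" for x
  have int_G: "integrable lborel G"
    using set_integrable_abs[OF int_g] unfolding set_integrable_def G_def by simp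
  have [measurable]: "G \<in> borel_measurable borel"
    using borel_measurable_integrable[OF int_G] by simp
  have G0: "G x \<ge> 0" for x by (auto simp: G_def)
  have "(\<lambda>n. \<integral>x. G x - min (G x) (real n) \<partial>lborel) \<longlonglongrightarrow> (\<integral>x. 0 \<partial>(lborel :: real measure))"
  proof (rule integral_dominated_convergence[where w = G])
    show "AE x in lborel. (\<lambda>n. G x - min (G x) (real n)) \<longlonglongrightarrow> 0"
    proof (intro AE_I2 tendsto_eventually)
      fix x
      obtain N where "G x \<le> real N" using real_arch_simple by blast
      then show "eventually (\<lambda>n. G x - min (G x) (real n) = 0) sequentially"
        by (intro eventually_sequentiallyI[of N]) (auto simp: min_def)
    qed
    show "AE x in lborel. norm (G x - min (G x) (real n)) \<le> G x" for n
      by (intro AE_I2) (auto simp: min_def G_def)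
  qed (use int_G in auto)
  then have "eventually (\<lambda>n. (\<integral>x. G x - min (G x) (real n) \<partial>lborel) < \<epsilon> / 2) sequentially"
    using \<open>\<epsilon> > 0\<close> by (intro order_tendstoD(2)) auto
  then obtain n where n: "(\<integral>x. G x - min (G x) (real n) \<partial>lborel) < \<epsilon> / 2"
    by (meson eventually_happens' sequentially_bot)
  \<comment> \<open>The excess over the truncation level \<open>n\<close>.\<close>
  define H where "H x = G x - min (G x) (real n)" for x
  have int_H: "integrable lborel H"
    unfolding H_def using int_G
    by (intro Bochner_Integration.integrable_diff) (auto intro!: Bochner_Integration.integrable_bound[OF int_G] simp: G0)
  have H0: "H x \<ge> 0" for x by (auto simp: H_def)
  have int_H_set: "set_integrable lborel A H" if "A \<in> sets borel" for A
    using int_H that unfolding set_integrable_def by (intro integrable_mult_indicator) auto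
  have incr: "\<bar>F y - F x\<bar> \<le> (LBINT t:{x<..<y}. H t) + real n * (y - x)"
    if "c \<le> x" "x < y" "y \<le> d" for x y
  proof -
    note I = is_indefinite_integralD[OF F, of x y]
    have const_int: "set_integrable lborel {x..y} (\<lambda>_. real n)"
      by (intro borel_integrable_atLeastAtMost' continuous_intros)
    have "\<bar>F y - F x\<bar> \<le> (LBINT t:{x..y}. \<bar>g t\<bar>)"
      using I that set_integral_norm_bound[of lborel "{x..y}" g] by auto
    also have "\<dots> \<le> (LBINT t:{x..y}. H t + real n)"
    proof (rule set_integral_mono)
      show "set_integrable lborel {x..y} (\<lambda>t. \<bar>g t\<bar>)" using I that by (intro set_integrable_abs) auto
      show "set_integrable lborel {x..y} (\<lambda>t. H t + real n)"
        by (intro set_integral_add int_H_set const_int) auto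
      show "\<bar>g t\<bar> \<le> H t + real n" if "t \<in> {x..y}" for t
        using that \<open>c \<le> x\<close> \<open>y \<le> d\<close> by (auto simp: H_def G_def)
    qed
    also have "\<dots> = (LBINT t:{x..y}. H t) + real n * (y - x)"
      using that by (subst set_integral_add) (auto simp: int_H_set const_int set_lebesgue_integral_def)
    also have "(LBINT t:{x..y}. H t) = (LBINT t:{x<..<y}. H t)"
      by (rule set_integral_discrete_difference[where X = "{x, y}"]) auto
    finally show ?thesis .
  qed
  show "\<exists>\<delta>>0. \<forall>S. finite S \<and> (\<forall>(x, y)\<in>S. c \<le> x \<and> x < y \<and> y \<le> d) \<and>
          disjoint_family_on (\<lambda>(x, y). {x<..<y}) S \<and> (\<Sum>(x, y)\<in>S. y - x) < \<delta> \<longrightarrow>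
          (\<Sum>(x, y)\<in>S. \<bar>F y - F x\<bar>) < \<epsilon>"
  proof (intro exI conjI allI impI; (elim conjE)?)
    show "\<epsilon> / (2 * (real n + 1)) > 0" using \<open>\<epsilon> > 0\<close> by simp
    fix S :: "(real \<times> real) set"
    assume S: "finite S" "\<forall>(x, y)\<in>S. c \<le> x \<and> x < y \<and> y \<le> d"
      "disjoint_family_on (\<lambda>(x, y). {x<..<y}) S" "(\<Sum>(x, y)\<in>S. y - x) < \<epsilon> / (2 * (real n + 1))"
    have "(\<Sum>(x, y)\<in>S. \<bar>F y - F x\<bar>) \<le> (\<Sum>(x, y)\<in>S. (LBINT t:{x<..<y}. H t) + real n * (y - x))"
      using S(2) by (intro sum_mono) (clarsimp, rule incr, auto)
    also have "\<dots> = (\<Sum>i\<in>S. LBINT t:(case i of (x, y) \<Rightarrow> {x<..<y}). H t) + real n * (\<Sum>(x, y)\<in>S. y - x)"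
      by (simp add: split_def sum.distrib sum_distrib_left)
    also have "(\<Sum>i\<in>S. LBINT t:(case i of (x, y) \<Rightarrow> {x<..<y}). H t) =
        (LBINT t:(\<Union>i\<in>S. case i of (x, y) \<Rightarrow> {x<..<y}). H t)"
      using S(1,3) int_H_set
      by (intro set_integral_finite_UN_AE[symmetric] AE_I2)
        (fastforce simp: disjoint_family_on_def split: prod.splits)+
    also have "\<dots> \<le> (\<integral>x. H x \<partial>lborel)"
    proof -
      define U where "U = (\<Union>i\<in>S. case i of (x, y) \<Rightarrow> {x<..<y})"
      have "U \<in> sets borel"
        using S(1) unfolding U_def by (intro sets.finite_UN) (auto split: prod.splits)
      then show ?thesis
        unfolding U_def[symmetric] set_lebesgue_integral_def
        using int_H_set[of U] H0 by (intro integral_mono int_H) (auto simp: indicator_def set_integrable_def)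
    qed
    also have "\<dots> < \<epsilon> / 2" using n by (simp add: H_def)
    also have "real n * (\<Sum>(x, y)\<in>S. y - x) \<le> (real n + 1) * (\<epsilon> / (2 * (real n + 1)))"
      using S by (intro mult_mono) (auto intro!: sum_nonneg)
    also have "\<dots> = \<epsilon> / 2" by (simp add: field_simps)
    finally show "(\<Sum>(x, y)\<in>S. \<bar>F y - F x\<bar>) < \<epsilon>" by simp
  qed
qed

section \<open>Stability properties of local absolute continuity\<close>

lemma loc_abs_cont_continuous:
  assumes f: "loc_abs_cont f"
  shows "continuous_on UNIV f"
  unfolding continuous_on_iff
proof (intro ballI allI impI)
  fix x \<epsilon> :: real assume "\<epsilon> > 0"
  have "abs_cont_on_interval (x - 1) (x + 1) f" using f by (simp add: loc_abs_cont_def)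
  from this \<open>\<epsilon> > 0\<close> obtain \<delta> where \<delta>: "\<delta> > 0"
    "\<And>S. finite S \<Longrightarrow> (\<forall>(u, v)\<in>S. x - 1 \<le> u \<and> u < v \<and> v \<le> x + 1) \<Longrightarrow>
        disjoint_family_on (\<lambda>(u, v). {u<..<v}) S \<Longrightarrow> (\<Sum>(u, v)\<in>S. v - u) < \<delta> \<Longrightarrow>
        (\<Sum>(u, v)\<in>S. \<bar>f v - f u\<bar>) < \<epsilon>"
    by (rule abs_cont_on_intervalE) (rule that)
  have pair: "\<bar>f v - f u\<bar> < \<epsilon>" if "x - 1 \<le> u" "u < v" "v \<le> x + 1" "v - u < \<delta>" for u v
    using \<delta>(2)[of "{(u, v)}"] that by (simp add: disjoint_family_on_def)
  show "\<exists>d>0. \<forall>y\<in>UNIV. dist y x < d \<longrightarrow> dist (f y) (f x) < \<epsilon>"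
  proof (intro exI conjI ballI impI)
    show "min \<delta> 1 > 0" using \<delta>(1) by simp
    fix y assume "dist y x < min \<delta> 1"
    then show "dist (f y) (f x) < \<epsilon>"
      using pair[of x y] pair[of y x] \<open>\<epsilon> > 0\<close>
      by (cases x y rule: linorder_cases) (auto simp: dist_real_def abs_minus_commute)
  qed
qed

lemma loc_abs_cont_mult:
  assumes F: "loc_abs_cont F" and G: "loc_abs_cont G"
  shows "loc_abs_cont (\<lambda>x. F x * G x)"
  unfolding loc_abs_cont_def abs_cont_on_interval_def
proof (intro allI impI)
  fix c d \<epsilon> :: real assume "c \<le> d" "\<epsilon> > 0"
  have "bounded (F ` {c..d})" "bounded (G ` {c..d})"
    using loc_abs_cont_continuous[OF F] loc_abs_cont_continuous[OF G]
    by (auto intro!: compact_imp_bounded compact_continuous_image intro: continuous_on_subset)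
  then obtain KF KG where "\<forall>x\<in>{c..d}. \<bar>F x\<bar> \<le> KF" "\<forall>x\<in>{c..d}. \<bar>G x\<bar> \<le> KG"
    unfolding bounded_iff by auto
  moreover define K where "K = max KF KG + 1"
  ultimately have bd: "\<bar>F x\<bar> \<le> K" "\<bar>G x\<bar> \<le> K" if "x \<in> {c..d}" for x
    using that by fastforce+
  have "K > 0"
  proof (rule ccontr)
    assume "\<not> K > 0"
    then have "KF + 1 \<le> 0" unfolding K_def by auto
    moreover have "0 \<le> KF" using \<open>\<forall>x\<in>{c..d}. \<bar>F x\<bar> \<le> KF\<close> \<open>c \<le> d\<close> by (meson abs_ge_zero atLeastAtMost_iff order_refl order_trans)
    ultimately show False by simp
  qed
  have e: "\<epsilon> / (2 * K) > 0" using \<open>\<epsilon> > 0\<close> \<open>K > 0\<close> by simp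
  obtain \<delta>1 where \<delta>1: "\<delta>1 > 0"
    "\<And>S. finite S \<Longrightarrow> (\<forall>(x, y)\<in>S. c \<le> x \<and> x < y \<and> y \<le> d) \<Longrightarrow>
        disjoint_family_on (\<lambda>(x, y). {x<..<y}) S \<Longrightarrow> (\<Sum>(x, y)\<in>S. y - x) < \<delta>1 \<Longrightarrow>
        (\<Sum>(x, y)\<in>S. \<bar>F y - F x\<bar>) < \<epsilon> / (2 * K)"
    by (rule abs_cont_on_intervalE[OF F[unfolded loc_abs_cont_def, rule_format, OF \<open>c \<le> d\<close>] e]) (rule that)
  obtain \<delta>2 where \<delta>2: "\<delta>2 > 0"
    "\<And>S. finite S \<Longrightarrow> (\<forall>(x, y)\<in>S. c \<le> x \<and> x < y \<and> y \<le> d) \<Longrightarrow>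
        disjoint_family_on (\<lambda>(x, y). {x<..<y}) S \<Longrightarrow> (\<Sum>(x, y)\<in>S. y - x) < \<delta>2 \<Longrightarrow>
        (\<Sum>(x, y)\<in>S. \<bar>G y - G x\<bar>) < \<epsilon> / (2 * K)"
    by (rule abs_cont_on_intervalE[OF G[unfolded loc_abs_cont_def, rule_format, OF \<open>c \<le> d\<close>] e]) (rule that)
  show "\<exists>\<delta>>0. \<forall>S. finite S \<and> (\<forall>(x, y)\<in>S. c \<le> x \<and> x < y \<and> y \<le> d) \<and>
          disjoint_family_on (\<lambda>(x, y). {x<..<y}) S \<and> (\<Sum>(x, y)\<in>S. y - x) < \<delta> \<longrightarrow>
          (\<Sum>(x, y)\<in>S. \<bar>F y * G y - F x * G x\<bar>) < \<epsilon>"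
  proof (intro exI conjI allI impI; (elim conjE)?)
    show "min \<delta>1 \<delta>2 > 0" using \<delta>1 \<delta>2 by auto
    fix S :: "(real \<times> real) set"
    assume S: "finite S" "\<forall>(x, y)\<in>S. c \<le> x \<and> x < y \<and> y \<le> d"
      "disjoint_family_on (\<lambda>(x, y). {x<..<y}) S" "(\<Sum>(x, y)\<in>S. y - x) < min \<delta>1 \<delta>2"
    have pt: "\<bar>F y * G y - F x * G x\<bar> \<le> K * \<bar>F y - F x\<bar> + K * \<bar>G y - G x\<bar>" if "(x, y) \<in> S" for x y
    proof -
      have xy: "x \<in> {c..d}" "y \<in> {c..d}" using S(2) that by auto
      have "F y * G y - F x * G x = G y * (F y - F x) + F x * (G y - G x)" by (simp add: algebra_simps)
      also have "\<bar>\<dots>\<bar> \<le> \<bar>G y\<bar> * \<bar>F y - F x\<bar> + \<bar>F x\<bar> * \<bar>G y - G x\<bar>"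
        by (rule order_trans[OF abs_triangle_ineq]) (simp add: abs_mult)
      also have "\<dots> \<le> K * \<bar>F y - F x\<bar> + K * \<bar>G y - G x\<bar>"
        using bd xy by (intro add_mono mult_right_mono) auto
      finally show ?thesis .
    qed
    have "(\<Sum>(x, y)\<in>S. \<bar>F y * G y - F x * G x\<bar>) \<le> (\<Sum>(x, y)\<in>S. K * \<bar>F y - F x\<bar> + K * \<bar>G y - G x\<bar>)"
      by (rule sum_mono) (clarify, rule pt)
    also have "\<dots> = K * (\<Sum>(x, y)\<in>S. \<bar>F y - F x\<bar>) + K * (\<Sum>(x, y)\<in>S. \<bar>G y - G x\<bar>)"
      by (simp add: split_def sum.distrib sum_distrib_left)
    also have "\<dots> < K * (\<epsilon> / (2 * K)) + K * (\<epsilon> / (2 * K))"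
      using S \<open>K > 0\<close> by (intro add_strict_mono mult_strict_left_mono \<delta>1(2) \<delta>2(2)) auto
    also have "\<dots> = \<epsilon>" using \<open>K > 0\<close> by simp
    finally show "(\<Sum>(x, y)\<in>S. \<bar>F y * G y - F x * G x\<bar>) < \<epsilon>" .
  qed
qed

lemma loc_abs_cont_add:
  assumes F: "loc_abs_cont F" and G: "loc_abs_cont G"
  shows "loc_abs_cont (\<lambda>x. F x + G x)"
  unfolding loc_abs_cont_def abs_cont_on_interval_def
proof (intro allI impI)
  fix c d \<epsilon> :: real assume "c \<le> d" "\<epsilon> > 0"
  then have e: "\<epsilon> / 2 > 0" by simp
  obtain \<delta>1 where \<delta>1: "\<delta>1 > 0"
    "\<And>S. finite S \<Longrightarrow> (\<forall>(x, y)\<in>S. c \<le> x \<and> x < y \<and> y \<le> d) \<Longrightarrow>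
        disjoint_family_on (\<lambda>(x, y). {x<..<y}) S \<Longrightarrow> (\<Sum>(x, y)\<in>S. y - x) < \<delta>1 \<Longrightarrow>
        (\<Sum>(x, y)\<in>S. \<bar>F y - F x\<bar>) < \<epsilon> / 2"
    by (rule abs_cont_on_intervalE[OF F[unfolded loc_abs_cont_def, rule_format, OF \<open>c \<le> d\<close>] e]) (rule that)
  obtain \<delta>2 where \<delta>2: "\<delta>2 > 0"
    "\<And>S. finite S \<Longrightarrow> (\<forall>(x, y)\<in>S. c \<le> x \<and> x < y \<and> y \<le> d) \<Longrightarrow>
        disjoint_family_on (\<lambda>(x, y). {x<..<y}) S \<Longrightarrow> (\<Sum>(x, y)\<in>S. y - x) < \<delta>2 \<Longrightarrow>
        (\<Sum>(x, y)\<in>S. \<bar>G y - G x\<bar>) < \<epsilon> / 2"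
    by (rule abs_cont_on_intervalE[OF G[unfolded loc_abs_cont_def, rule_format, OF \<open>c \<le> d\<close>] e]) (rule that)
  show "\<exists>\<delta>>0. \<forall>S. finite S \<and> (\<forall>(x, y)\<in>S. c \<le> x \<and> x < y \<and> y \<le> d) \<and>
          disjoint_family_on (\<lambda>(x, y). {x<..<y}) S \<and> (\<Sum>(x, y)\<in>S. y - x) < \<delta> \<longrightarrow>
          (\<Sum>(x, y)\<in>S. \<bar>F y + G y - (F x + G x)\<bar>) < \<epsilon>"
  proof (intro exI conjI allI impI; (elim conjE)?)
    show "min \<delta>1 \<delta>2 > 0" using \<delta>1 \<delta>2 by auto
    fix S :: "(real \<times> real) set"
    assume S: "finite S" "\<forall>(x, y)\<in>S. c \<le> x \<and> x < y \<and> y \<le> d"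
      "disjoint_family_on (\<lambda>(x, y). {x<..<y}) S" "(\<Sum>(x, y)\<in>S. y - x) < min \<delta>1 \<delta>2"
    have "(\<Sum>(x, y)\<in>S. \<bar>F y + G y - (F x + G x)\<bar>) \<le> (\<Sum>(x, y)\<in>S. \<bar>F y - F x\<bar> + \<bar>G y - G x\<bar>)"
      by (rule sum_mono) (clarify, linarith)
    also have "\<dots> = (\<Sum>(x, y)\<in>S. \<bar>F y - F x\<bar>) + (\<Sum>(x, y)\<in>S. \<bar>G y - G x\<bar>)"
      by (simp add: split_def sum.distrib)
    also have "\<dots> < \<epsilon> / 2 + \<epsilon> / 2"
      using S by (intro add_strict_mono \<delta>1(2) \<delta>2(2)) auto
    finally show "(\<Sum>(x, y)\<in>S. \<bar>F y + G y - (F x + G x)\<bar>) < \<epsilon>" by simp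
  qed
qed

lemma C1_is_indefinite_integral:
  assumes "\<And>x. (F has_real_derivative g x) (at x)" "continuous_on UNIV g"
  shows "is_indefinite_integral F g"
  unfolding is_indefinite_integral_def
proof (intro allI impI)
  fix c d :: real assume "c \<le> d"
  have "has_bochner_integral lborel (\<lambda>x. g x * indicator {c..d} x) (F d - F c)"
    using assms \<open>c \<le> d\<close>
    by (intro has_bochner_integral_FTC_Icc_real) (auto simp: continuous_on_eq_continuous_at)
  then show "set_integrable lborel {c..d} g \<and> F d - F c = (LBINT x:{c..d}. g x)"
    by (simp add: has_bochner_integral_iff set_integrable_def set_lebesgue_integral_def mult.commute)
qed

text \<open>The hypothesis concerns increments, as in the conclusion of \<open>AE_derivative_has_integral\<close>; together with a
continuous integrand it upgrades almost everywhere differentiability to differentiability at every point.\<close>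

lemma has_integral_derivative:
  assumes F: "\<And>c d. c \<le> d \<Longrightarrow> (g has_integral (F d - F c)) {c..d}" and g: "continuous_on UNIV g"
  shows "(F has_real_derivative g x) (at x)"
proof -
  have D: "((\<lambda>y. F (x-1) + integral {x-1..y} g) has_real_derivative 0 + g x) (at x within {x-1..x+1})"
    using continuous_on_subset[OF g]
    by (intro DERIV_add DERIV_const integral_has_real_derivative) auto
  have eq: "F (x - 1) + integral {x - 1..y} g = F y" if "y \<in> {x-1..x+1}" for y
    using F[of "x-1" y] that by (simp add: integral_unique)
  have "(F has_real_derivative 0 + g x) (at x within {x-1..x+1})"
    by (rule has_field_derivative_transform_within[OF D, where d = 1]) (auto intro: eq)
  then show ?thesis using at_within_interior[of x "{x-1..x+1}"] by simp
qed

lemma loc_abs_cont_derivative: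
  assumes "loc_abs_cont F" "AE x in lebesgue. (F has_real_derivative g x) (at x)" "continuous_on UNIV g"
  shows "(F has_real_derivative g x) (at x)"
  using assms by (intro has_integral_derivative AE_derivative_has_integral) (auto simp: loc_abs_cont_def)

section \<open>Lipschitz functions on the line\<close>

text \<open>Adding a multiple of the identity turns \<open>h\<close> into a function \<open>G\<close> that is bi-Lipschitz and increasing. The image of
Lebesgue measure under the inverse of \<open>G\<close> gives each interval the increment of \<open>G\<close> as its mass, and is absolutely
continuous because Lipschitz maps preserve null sets. By the Radon--Nikodym theorem \<open>G\<close> is an indefinite integral,
and Lebesgue's differentiation theorem applies.\<close>

lemma lipschitz_AE_differentiable:
  fixes h :: "real \<Rightarrow> real"
  assumes L: "L-lipschitz_on UNIV h"
  shows "AE x in lebesgue. h differentiable (at x)"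
proof -
  have hL: "\<bar>h y - h x\<bar> \<le> L * \<bar>y - x\<bar>" for x y
    using lipschitz_onD[OF L, of y x] by (simp add: dist_real_def)
  \<comment> \<open>The slope \<open>L + 1\<close> makes all difference quotients of \<open>G\<close> at least \<open>1\<close>.\<close>
  define G where "G x = h x + (L + 1) * x" for x
  have G_expand: "G y - G x \<ge> y - x" if "x \<le> y" for x y
    using hL[of y x] that by (auto simp: G_def algebra_simps abs_if split: if_splits)
  have G_less: "G x < G y" if "x < y" for x y
    using G_expand[of x y] that by auto
  have G_le: "G x \<le> G y \<longleftrightarrow> x \<le> y" for x y
    using G_less[of x y] G_less[of y x] by (cases x y rule: linorder_cases) auto
  have G_lip: "\<bar>G y - G x\<bar> \<le> (2 * L + 1) * \<bar>y - x\<bar>" for x y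
  proof -
    have "G y - G x = (h y - h x) + (L + 1) * (y - x)" by (simp add: G_def algebra_simps)
    also have "\<bar>\<dots>\<bar> \<le> \<bar>h y - h x\<bar> + (L + 1) * \<bar>y - x\<bar>"
      using lipschitz_on_nonneg[OF L] by (intro order_trans[OF abs_triangle_ineq]) (simp add: abs_mult)
    also have "\<dots> \<le> L * \<bar>y - x\<bar> + (L + 1) * \<bar>y - x\<bar>" using hL[of y x] by simp
    finally show ?thesis by (simp add: algebra_simps)
  qed
  have G_cont: "continuous_on UNIV G"
    unfolding G_def by (intro continuous_intros lipschitz_on_continuous_on[OF L])
  have inj_G: "inj G" using G_le by (metis injI order_antisym order_refl)
  have surj_G: "surj G"
    unfolding surj_def
  proof
    fix z
    let ?m = "\<bar>z\<bar> + \<bar>G 0\<bar>"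
    have m: "- ?m \<le> 0" "0 \<le> ?m" by auto
    have "G (- ?m) \<le> z" "z \<le> G ?m"
      using G_expand[OF m(1)] G_expand[OF m(2)] by linarith+
    then obtain x where "G x = z"
      using IVT'[of G "- ?m" z ?m] continuous_on_subset[OF G_cont] by auto
    then show "\<exists>x. z = G x" by blast
  qed
  define H where "H = inv G"
  have HG: "H (G x) = x" and GH: "G (H z) = z" for x z
    using inj_G surj_G by (auto simp: H_def surj_f_inv_f)
  have H_le: "H u \<le> H v \<longleftrightarrow> u \<le> v" for u v
    using G_le[of "H u" "H v"] by (simp add: GH)
  have H_meas [measurable]: "H \<in> borel_measurable borel"
    using H_le by (intro borel_measurable_mono monoI) auto
  define \<mu> where "\<mu> = distr lborel borel H"
  have vimage: "H -` A = G ` A" for A using HG GH by (auto simp: image_iff) (metis GH)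
  have \<mu>: "emeasure \<mu> {x..y} = ennreal (G y - G x)" if "x \<le> y" for x y
  proof -
    have "H -` {x..y} = {G x..G y}"
      using H_le[of "G x"] H_le[of _ "G y"] by (auto simp: HG)
    then show ?thesis using that G_le[of x y] by (simp add: \<mu>_def emeasure_distr)
  qed
  have "absolutely_continuous lborel \<mu>"
    unfolding absolutely_continuous_def
  proof
    fix A :: "real set" assume A: "A \<in> null_sets lborel"
    then have "negligible A" by (simp add: negligible_iff_null_sets null_sets_completionI)
    then have "negligible (G ` A)"
      using G_lip by (intro negligible_locally_Lipschitz_image) (auto intro!: exI[of _ UNIV] simp: real_norm_def)
    moreover have "H -` A \<in> sets borel" using A measurable_sets[OF H_meas, of A] by auto
    ultimately have "emeasure lborel (H -` A) = 0"
      by (simp add: vimage negligible_iff_null_sets null_sets_def)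
    then show "A \<in> null_sets \<mu>"
      using A by (auto simp: \<mu>_def emeasure_distr null_sets_def)
  qed
  then obtain f where f: "f \<in> borel_measurable lborel" "density lborel f = \<mu>"
    using sigma_finite_measure.Radon_Nikodym[OF sigma_finite_lborel, of \<mu>] by (auto simp: \<mu>_def)
  define g where "g x = enn2real (f x)" for x
  have f_meas [measurable]: "f \<in> borel_measurable borel" using f(1) by simp
  have [measurable]: "g \<in> borel_measurable borel" unfolding g_def by measurable
  have nn: "(\<integral>\<^sup>+x. f x * indicator {c..d} x \<partial>lborel) = ennreal (G d - G c)" if "c \<le> d" for c d
    using \<mu>[OF that] f by (metis emeasure_density lborel_eq_real atLeastAtMost_borel sets_lborel)
  have "is_indefinite_integral G g"
    unfolding is_indefinite_integral_def
  proof (intro allI impI)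
    fix c d :: real assume "c \<le> d"
    have "AE x in lborel. f x * indicator {c..d} x \<noteq> \<infinity>"
      using nn[OF \<open>c \<le> d\<close>] by (intro nn_integral_noteq_infinite) auto
    then have "(\<integral>\<^sup>+x. ennreal (indicator {c..d} x * g x) \<partial>lborel) = (\<integral>\<^sup>+x. f x * indicator {c..d} x \<partial>lborel)"
      by (intro nn_integral_cong_AE) (auto elim!: eventually_mono simp: g_def indicator_def less_top)
    then have "has_bochner_integral lborel (\<lambda>x. indicator {c..d} x * g x) (G d - G c)"
      using nn[OF \<open>c \<le> d\<close>] G_le[of c d] \<open>c \<le> d\<close>
      by (intro has_bochner_integral_nn_integral) (auto simp: g_def)
    then show "set_integrable lborel {c..d} g \<and> G d - G c = (LBINT x:{c..d}. g x)"
      unfolding has_bochner_integral_iff by (simp add: set_integrable_def set_lebesgue_integral_def)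
  qed
  from is_indefinite_integral_AE_derivative[OF this] show ?thesis
  proof (rule eventually_mono)
    fix x assume "(G has_real_derivative g x) (at x)"
    then have "((\<lambda>x. G x - (L + 1) * x) has_real_derivative (g x - (L + 1))) (at x)"
      by (auto intro!: derivative_eq_intros)
    then have "(h has_real_derivative (g x - (L + 1))) (at x)" by (simp add: G_def)
    then show "h differentiable (at x)" using real_differentiable_def by blast
  qed
qed

lemma lipschitz_loc_abs_cont:
  assumes "L-lipschitz_on UNIV h"
  shows "loc_abs_cont h"
  unfolding loc_abs_cont_def abs_cont_on_interval_def
proof (intro allI impI)
  fix c d \<epsilon> :: real assume "\<epsilon> > 0"
  have L: "L \<ge> 0" by (rule lipschitz_on_nonneg[OF assms])
  show "\<exists>\<delta>>0. \<forall>S. finite S \<and> (\<forall>(x, y)\<in>S. c \<le> x \<and> x < y \<and> y \<le> d) \<and>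
          disjoint_family_on (\<lambda>(x, y). {x<..<y}) S \<and> (\<Sum>(x, y)\<in>S. y - x) < \<delta> \<longrightarrow>
          (\<Sum>(x, y)\<in>S. \<bar>h y - h x\<bar>) < \<epsilon>"
  proof (intro exI conjI allI impI; (elim conjE)?)
    show "\<epsilon> / (L + 1) > 0" using \<open>\<epsilon> > 0\<close> L by simp
    fix S :: "(real \<times> real) set"
    assume S: "\<forall>(x, y)\<in>S. c \<le> x \<and> x < y \<and> y \<le> d" "(\<Sum>(x, y)\<in>S. y - x) < \<epsilon> / (L + 1)"
    have pt: "\<bar>h y - h x\<bar> \<le> (L + 1) * (y - x)" if "(x, y) \<in> S" for x y
    proof -
      have "x < y" using S that by auto
      then show ?thesis using lipschitz_onD[OF assms, of y x] by (simp add: dist_real_def algebra_simps)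
    qed
    have "(\<Sum>(x, y)\<in>S. \<bar>h y - h x\<bar>) \<le> (\<Sum>(x, y)\<in>S. (L + 1) * (y - x))"
      by (rule sum_mono) (clarify, rule pt)
    also have "\<dots> = (L + 1) * (\<Sum>(x, y)\<in>S. y - x)" by (simp add: split_def sum_distrib_left)
    also have "\<dots> < (L + 1) * (\<epsilon> / (L + 1))" using S L by (intro mult_strict_left_mono) auto
    also have "\<dots> = \<epsilon>" using L by simp
    finally show "(\<Sum>(x, y)\<in>S. \<bar>h y - h x\<bar>) < \<epsilon>" .
  qed
qed

text \<open>The increments of \<open>h\<close> are integrals of its derivative, so an almost everywhere bound for the derivative improves
the Lipschitz constant.\<close>

lemma lipschitz_of_AE_deriv_bound:
  assumes h: "L-lipschitz_on UNIV h" and K: "AE x in lebesgue. \<bar>deriv h x\<bar> \<le> K" "K \<ge> 0"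
  shows "K-lipschitz_on UNIV h"
proof -
  \<comment> \<open>The derivative is clipped to satisfy the bound everywhere, as the estimate of the integral requires.\<close>
  define g where "g x = max (- K) (min K (deriv h x))" for x
  have "AE x in lebesgue. (h has_real_derivative g x) (at x)"
    using lipschitz_AE_differentiable[OF h] K(1)
    by eventually_elim (auto simp: g_def min_def max_def DERIV_deriv_iff_real_differentiable)
  then have int: "(g has_integral (h d - h c)) {c..d}" if "c \<le> d" for c d
    using lipschitz_loc_abs_cont[OF h] that by (intro AE_derivative_has_integral) (auto simp: loc_abs_cont_def)
  have bd: "\<bar>g x\<bar> \<le> K" for x using K(2) by (auto simp: g_def)
  have le: "\<bar>h d - h c\<bar> \<le> K * (d - c)" if "c \<le> d" for c d
    using has_integral_bound_real[OF K(2) finite.emptyI int[OF that]] that bd by auto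
  show ?thesis
  proof (rule lipschitz_onI)
    fix x y show "dist (h x) (h y) \<le> K * dist x y"
      using le[of x y] le[of y x] by (cases "x \<le> y") (auto simp: dist_real_def abs_minus_commute)
  qed (rule K(2))
qed

lemma lipschitz_deriv_bound:
  assumes h: "K-lipschitz_on UNIV (h :: real \<Rightarrow> real)" and "h differentiable (at x)"
  shows "\<bar>deriv h x\<bar> \<le> K"
proof -
  have "((\<lambda>y. (h (x + y) - h x) / y) \<longlongrightarrow> deriv h x) (at 0)"
    using assms(2) by (simp add: DERIV_deriv_iff_real_differentiable[symmetric] DERIV_def)
  then have "((\<lambda>y. \<bar>(h (x + y) - h x) / y\<bar>) \<longlongrightarrow> \<bar>deriv h x\<bar>) (at 0)" by (rule tendsto_rabs)
  then show ?thesis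
  proof (rule tendsto_upperbound)
    show "eventually (\<lambda>y. \<bar>(h (x + y) - h x) / y\<bar> \<le> K) (at 0)"
      using lipschitz_onD[OF h, of "x + _" x]
      by (intro eventually_at_filter[THEN iffD2] always_eventually allI impI)
        (simp add: dist_real_def divide_le_eq abs_divide)
  qed simp
qed

lemma loc_abs_cont_cmult:
  assumes "loc_abs_cont F"
  shows "loc_abs_cont (\<lambda>x. c * F x)"
proof (rule loc_abs_cont_mult[OF _ assms])
  show "loc_abs_cont (\<lambda>x. c)"
    by (rule lipschitz_loc_abs_cont[where L = 0]) (auto simp: lipschitz_on_def)
qed

section \<open>The essential supremum norm\<close>

lemma ess_norm_le:
  assumes "g \<in> borel_measurable lebesgue" "AE x in lebesgue. \<bar>g x\<bar> \<le> K"
  shows "ess_norm g \<le> ereal K"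
  unfolding ess_norm_def using assms by (intro esssup_I) auto

text \<open>For an essentially bounded function the extended real \<open>ess_norm g\<close> is a real number, and it is attained as an
almost everywhere bound. That it is not negative uses that the line is not a null set.\<close>

lemma ess_norm_finite:
  assumes g: "g \<in> borel_measurable lebesgue" and L: "AE x in lebesgue. \<bar>g x\<bar> \<le> L"
  obtains K where "K \<ge> 0" "ess_norm g = ereal K" "AE x in lebesgue. \<bar>g x\<bar> \<le> K"
proof -
  have AE: "AE x in lebesgue. ereal \<bar>g x\<bar> \<le> ess_norm g" unfolding ess_norm_def by (rule esssup_AE)
  have "\<exists>x. ereal \<bar>g x\<bar> \<le> ess_norm g"
  proof (rule ccontr)
    assume "\<nexists>x. ereal \<bar>g x\<bar> \<le> ess_norm g"
    then have "negligible (UNIV :: real set)"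
      using AE unfolding eventually_ae_filter_negligible by (auto dest: top.extremum_uniqueI)
    then show False by simp
  qed
  then have "0 \<le> ess_norm g" by (metis abs_ge_zero ereal_less_eq(5) order_trans)
  moreover have "ess_norm g \<le> ereal L" by (rule ess_norm_le[OF g L])
  ultimately obtain K where "K \<ge> 0" "ess_norm g = ereal K"
    by (cases "ess_norm g") auto
  moreover from this have "AE x in lebesgue. \<bar>g x\<bar> \<le> K" using AE by simp
  ultimately show ?thesis using that by blast
qed

text \<open>Lebesgue measure is complete.\<close>

lemma borel_measurable_lebesgue_AE_eq:
  fixes f g :: "real \<Rightarrow> real"
  assumes "g \<in> borel_measurable borel" "AE x in lebesgue. f x = g x"
  shows "f \<in> borel_measurable lebesgue"
proof (rule measurableI)
  fix A :: "real set" assume "A \<in> sets borel"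
  then have gA: "g -` A \<in> sets lebesgue"
    using measurable_sets[OF assms(1), of A] by auto
  have "AE x in lebesgue. x \<in> g -` A \<longleftrightarrow> x \<in> f -` A"
    using assms(2) by eventually_elim auto
  from completion.in_sets_AE[OF this gA] show "f -` A \<inter> space lebesgue \<in> sets lebesgue" by simp
qed simp

text \<open>Almost everywhere the derivative is the limit of difference quotients along a sequence, and completeness of
Lebesgue measure takes care of the arbitrary values on the exceptional null set.\<close>

lemma deriv_lebesgue_measurable:
  fixes f :: "real \<Rightarrow> real"
  assumes f: "continuous_on UNIV f" and diff: "AE x in lebesgue. f differentiable (at x)"
  shows "deriv f \<in> borel_measurable lebesgue"
proof (rule borel_measurable_lebesgue_AE_eq)
  have [measurable]: "f \<in> borel_measurable borel" using f by (rule borel_measurable_continuous_onI)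
  show "(\<lambda>x. lim (\<lambda>n. (f (x + inverse (real (Suc n))) - f x) / inverse (real (Suc n)))) \<in> borel_measurable borel"
    by (intro borel_measurable_lim_metric) measurable
  show "AE x in lebesgue. deriv f x = lim (\<lambda>n. (f (x + inverse (real (Suc n))) - f x) / inverse (real (Suc n)))"
    using diff
  proof (rule eventually_mono)
    fix x assume "f differentiable (at x)"
    then have "((\<lambda>y. (f (x + y) - f x) / y) \<longlongrightarrow> deriv f x) (at 0)"
      by (simp add: DERIV_deriv_iff_real_differentiable[symmetric] DERIV_def)
    moreover have "filterlim (\<lambda>n. inverse (real (Suc n))) (at 0) sequentially"
      using LIMSEQ_inverse_real_of_nat by (auto simp: filterlim_at)
    ultimately have "(\<lambda>n. (f (x + inverse (real (Suc n))) - f x) / inverse (real (Suc n))) \<longlonglongrightarrow> deriv f x"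
      by (rule filterlim_compose)
    then show "deriv f x = lim (\<lambda>n. (f (x + inverse (real (Suc n))) - f x) / inverse (real (Suc n)))"
      by (rule limI[symmetric])
  qed
qed

lemma lipschitz_ess_norm_deriv_le:
  fixes h :: "real \<Rightarrow> real"
  assumes h: "K-lipschitz_on UNIV h"
  shows "ess_norm (deriv h) \<le> ereal K"
proof (rule ess_norm_le)
  note diff = lipschitz_AE_differentiable[OF h]
  show "deriv h \<in> borel_measurable lebesgue"
    by (rule deriv_lebesgue_measurable[OF lipschitz_on_continuous_on[OF h] diff])
  show "AE x in lebesgue. \<bar>deriv h x\<bar> \<le> K"
    using diff by eventually_elim (rule lipschitz_deriv_bound[OF h])
qed

text \<open>Converts bounds for a derivative into bounds for increments: the norm is attained as an almost everywhere bound,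
and integrating the derivative makes it a Lipschitz constant.\<close>

lemma lipschitz_ess_norm_deriv:
  fixes h :: "real \<Rightarrow> real"
  assumes h: "L-lipschitz_on UNIV h"
  obtains K where "ess_norm (deriv h) = ereal K" "K-lipschitz_on UNIV h"
proof -
  note diff = lipschitz_AE_differentiable[OF h]
  have "deriv h \<in> borel_measurable lebesgue"
    by (rule deriv_lebesgue_measurable[OF lipschitz_on_continuous_on[OF h] diff])
  moreover have "AE x in lebesgue. \<bar>deriv h x\<bar> \<le> L"
    using diff by eventually_elim (rule lipschitz_deriv_bound[OF h])
  ultimately obtain K where "K \<ge> 0" "ess_norm (deriv h) = ereal K" "AE x in lebesgue. \<bar>deriv h x\<bar> \<le> K"
    by (rule ess_norm_finite)
  then show ?thesis using that lipschitz_of_AE_deriv_bound[OF h] by blast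
qed

section \<open>The resolvents of the differentiation operator\<close>

text \<open>The solution \<open>u = (p - D)\<^sup>-\<^sup>1 r\<close> of \<open>p u - u' = r\<close> that does not grow like \<open>exp (p x)\<close> at \<open>\<infinity>\<close>.\<close>

definition resolvent_right :: "real \<Rightarrow> (real \<Rightarrow> real) \<Rightarrow> real \<Rightarrow> real" where
  "resolvent_right p r x = exp (p * x) * (LBINT t:{x..}. exp (- p * t) * r t)"

text \<open>The solution \<open>u = (q + D)\<^sup>-\<^sup>1 r\<close> of \<open>q u + u' = r\<close> that does not grow like \<open>exp (- q x)\<close> at \<open>-\<infinity>\<close>.\<close>

definition resolvent_left :: "real \<Rightarrow> (real \<Rightarrow> real) \<Rightarrow> real \<Rightarrow> real" where
  "resolvent_left q r x = exp (- q * x) * (LBINT t:{..x}. exp (q * t) * r t)"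

definition exp_integrable_right :: "real \<Rightarrow> (real \<Rightarrow> real) \<Rightarrow> bool" where
  "exp_integrable_right p r \<longleftrightarrow> (\<forall>x. set_integrable lborel {x..} (\<lambda>t. exp (- p * t) * r t))"

definition exp_integrable_left :: "real \<Rightarrow> (real \<Rightarrow> real) \<Rightarrow> bool" where
  "exp_integrable_left q r \<longleftrightarrow> (\<forall>x. set_integrable lborel {..x} (\<lambda>t. exp (q * t) * r t))"

lemma set_integrable_reflect_atMost:
  "set_integrable lborel {..x} f \<longleftrightarrow> set_integrable lborel {- x..} (\<lambda>t. f (- t))"
  for x :: real and f :: "real \<Rightarrow> real"
proof -
  have "set_integrable lborel {..x} f \<longleftrightarrow> integrable lborel (\<lambda>t. indicator {..x} t * f t)"
    by (simp add: set_integrable_def)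
  also have "\<dots> \<longleftrightarrow> integrable lborel (\<lambda>t. indicator {..x} (0 + (-1) * t) * f (0 + (-1) * t))"
    by (rule lborel_integrable_real_affine_iff[symmetric]) simp
  also have "(\<lambda>t. indicator {..x} (0 + (-1) * t) * f (0 + (-1) * t)) = (\<lambda>t. indicator {- x..} t * f (- t))"
    by (auto simp: indicator_def)
  finally show ?thesis by (simp add: set_integrable_def)
qed

lemma exp_integrable_left_reflect:
  "exp_integrable_left q r \<longleftrightarrow> exp_integrable_right q (\<lambda>t. r (- t))"
proof -
  have "exp_integrable_left q r \<longleftrightarrow> (\<forall>x. set_integrable lborel {- x..} (\<lambda>t. exp (- q * t) * r (- t)))"
    by (simp add: exp_integrable_left_def set_integrable_reflect_atMost)
  also have "\<dots> \<longleftrightarrow> exp_integrable_right q (\<lambda>t. r (- t))"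
    unfolding exp_integrable_right_def by (rule iffI; intro allI; drule_tac x = "- x" in spec; simp)
  finally show ?thesis .
qed

text \<open>Reflection at the origin exchanges the two resolvents; it transfers estimates from the right to the left one.\<close>

lemma resolvent_left_reflect:
  "resolvent_left q r x = resolvent_right q (\<lambda>t. r (- t)) (- x)"
proof -
  have *: "{t. - t \<in> {..x}} = {- x..}" by auto
  show ?thesis
    unfolding resolvent_left_def resolvent_right_def
    by (subst set_integral_reflect, unfold *) simp
qed

lemma tail_integral_is_indefinite_integral:
  fixes f :: "real \<Rightarrow> real"
  assumes "\<And>x. set_integrable lborel {x..} f"
  shows "is_indefinite_integral (\<lambda>x. LBINT t:{x..}. f t) (\<lambda>t. - f t)"
  unfolding is_indefinite_integral_def
proof (intro allI impI)
  fix c d :: real assume "c \<le> d"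
  have cd: "set_integrable lborel {c..d} f" and d: "set_integrable lborel {d<..} f"
    using \<open>c \<le> d\<close> by (auto intro: set_integrable_subset[OF assms[of c]])
  have "{c..} = {c..d} \<union> {d<..}" using \<open>c \<le> d\<close> by auto
  then have "(LBINT t:{c..}. f t) = (LBINT t:{c..d}. f t) + (LBINT t:{d<..}. f t)"
    using set_integral_Un[OF _ cd d] by (auto simp: disjoint_iff)
  also have "(LBINT t:{d<..}. f t) = (LBINT t:{d..}. f t)"
    by (rule set_integral_discrete_difference[where X = "{d}"]) auto
  finally show "set_integrable lborel {c..d} (\<lambda>t. - f t) \<and>
      (LBINT t:{d..}. f t) - (LBINT t:{c..}. f t) = (LBINT t:{c..d}. - f t)"
    using cd by (simp add: set_integrable_def set_lebesgue_integral_def)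
qed

lemma head_integral_is_indefinite_integral:
  fixes f :: "real \<Rightarrow> real"
  assumes "\<And>x. set_integrable lborel {..x} f"
  shows "is_indefinite_integral (\<lambda>x. LBINT t:{..x}. f t) f"
  unfolding is_indefinite_integral_def
proof (intro allI impI)
  fix c d :: real assume "c \<le> d"
  have cd: "set_integrable lborel {c..d} f" and cd': "set_integrable lborel {c<..d} f"
    using \<open>c \<le> d\<close> by (auto intro: set_integrable_subset[OF assms[of d]])
  have "{..d} = {..c} \<union> {c<..d}" using \<open>c \<le> d\<close> by auto
  then have "(LBINT t:{..d}. f t) = (LBINT t:{..c}. f t) + (LBINT t:{c<..d}. f t)"
    using set_integral_Un[OF _ assms[of c] cd'] by (auto simp: disjoint_iff)
  also have "(LBINT t:{c<..d}. f t) = (LBINT t:{c..d}. f t)"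
    by (rule set_integral_discrete_difference[where X = "{c}"]) auto
  finally show "set_integrable lborel {c..d} f \<and>
      (LBINT t:{..d}. f t) - (LBINT t:{..c}. f t) = (LBINT t:{c..d}. f t)"
    using cd by simp
qed

lemma exp_loc_abs_cont: "loc_abs_cont (\<lambda>x. exp (p * x))"
  by (rule is_indefinite_integral_loc_abs_cont[OF C1_is_indefinite_integral[where g = "\<lambda>x. p * exp (p * x)"]])
    (auto intro!: derivative_eq_intros continuous_intros)

lemma
  assumes r: "exp_integrable_right p r"
  shows resolvent_right_loc_abs_cont: "loc_abs_cont (resolvent_right p r)"
    and resolvent_right_AE_derivative:
      "AE x in lebesgue. (resolvent_right p r has_real_derivative (p * resolvent_right p r x - r x)) (at x)"
proof -
  let ?I = "\<lambda>x. LBINT t:{x..}. exp (- p * t) * r t"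
  have eq: "resolvent_right p r = (\<lambda>x. exp (p * x) * ?I x)"
    by (simp add: resolvent_right_def fun_eq_iff)
  have I: "is_indefinite_integral ?I (\<lambda>t. - (exp (- p * t) * r t))"
    using r unfolding exp_integrable_right_def by (intro tail_integral_is_indefinite_integral) auto
  show "loc_abs_cont (resolvent_right p r)"
    unfolding eq by (intro loc_abs_cont_mult exp_loc_abs_cont is_indefinite_integral_loc_abs_cont[OF I])
  show "AE x in lebesgue. (resolvent_right p r has_real_derivative (p * resolvent_right p r x - r x)) (at x)"
    using is_indefinite_integral_AE_derivative[OF I]
  proof (rule eventually_mono)
    fix x assume "(?I has_real_derivative - (exp (- p * x) * r x)) (at x)"
    then have "((\<lambda>x. exp (p * x) * ?I x) has_real_derivative
        (p * (exp (p * x) * ?I x) + exp (p * x) * - (exp (- p * x) * r x))) (at x)"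
      by (auto intro!: derivative_eq_intros)
    then show "(resolvent_right p r has_real_derivative (p * resolvent_right p r x - r x)) (at x)"
      unfolding eq by (simp add: mult.assoc[symmetric] exp_add[symmetric])
  qed
qed

lemma
  assumes r: "exp_integrable_left q r"
  shows resolvent_left_loc_abs_cont: "loc_abs_cont (resolvent_left q r)"
    and resolvent_left_AE_derivative:
      "AE x in lebesgue. (resolvent_left q r has_real_derivative (r x - q * resolvent_left q r x)) (at x)"
proof -
  let ?I = "\<lambda>x. LBINT t:{..x}. exp (q * t) * r t"
  have eq: "resolvent_left q r = (\<lambda>x. exp (- q * x) * ?I x)"
    by (simp add: resolvent_left_def fun_eq_iff)
  have I: "is_indefinite_integral ?I (\<lambda>t. exp (q * t) * r t)"
    using r unfolding exp_integrable_left_def by (intro head_integral_is_indefinite_integral) auto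
  show "loc_abs_cont (resolvent_left q r)"
    unfolding eq by (intro loc_abs_cont_mult exp_loc_abs_cont is_indefinite_integral_loc_abs_cont[OF I])
  show "AE x in lebesgue. (resolvent_left q r has_real_derivative (r x - q * resolvent_left q r x)) (at x)"
    using is_indefinite_integral_AE_derivative[OF I]
  proof (rule eventually_mono)
    fix x assume "(?I has_real_derivative (exp (q * x) * r x)) (at x)"
    then have "((\<lambda>x. exp (- q * x) * ?I x) has_real_derivative
        (- q * (exp (- q * x) * ?I x) + exp (- q * x) * (exp (q * x) * r x))) (at x)"
      by (auto intro!: derivative_eq_intros)
    then show "(resolvent_left q r has_real_derivative (r x - q * resolvent_left q r x)) (at x)"
      unfolding eq by (simp add: mult.assoc[symmetric] exp_add[symmetric])
  qed
qed

lemma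
  fixes p c :: real
  assumes "p > 0"
  shows exp_minus_set_integrable: "set_integrable lborel {c..} (\<lambda>t. exp (- p * t))"
    and exp_minus_set_integral: "(LBINT t:{c..}. exp (- p * t)) = exp (- p * c) / p"
proof -
  note hi = has_integral_exp_minus_to_infinity[OF assms, of c]
  have "(\<lambda>t. exp (- p * t)) absolutely_integrable_on {c..}"
    using hi by (intro nonnegative_absolutely_integrable_1) auto
  then show *: "set_integrable lborel {c..} (\<lambda>t. exp (- p * t))"
    unfolding set_integrable_def by (subst (asm) integrable_completion) auto
  show "(LBINT t:{c..}. exp (- p * t)) = exp (- p * c) / p"
    using set_borel_integral_eq_integral(2)[OF *] hi by (simp add: integral_unique)
qed

text \<open>The exponential weight has total mass \<open>1/p\<close>.\<close>

lemma resolvent_right_bound: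
  assumes "p > 0" and r: "exp_integrable_right p r" and K: "AE x in lborel. \<bar>r x\<bar> \<le> K"
  shows "\<bar>resolvent_right p r x\<bar> \<le> K / p"
proof -
  have int: "set_integrable lborel {x..} (\<lambda>t. exp (- p * t) * r t)"
    using r by (auto simp: exp_integrable_right_def)
  have "\<bar>LBINT t:{x..}. exp (- p * t) * r t\<bar> \<le> (LBINT t:{x..}. \<bar>exp (- p * t) * r t\<bar>)"
    using set_integral_norm_bound[OF int] by simp
  also have "\<dots> \<le> (LBINT t:{x..}. exp (- p * t) * K)"
    unfolding set_lebesgue_integral_def
  proof (rule integral_mono_AE)
    show "integrable lborel (\<lambda>t. indicat_real {x..} t *\<^sub>R \<bar>exp (- p * t) * r t\<bar>)"
      using set_integrable_abs[OF int] by (simp add: set_integrable_def)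
    show "integrable lborel (\<lambda>t. indicat_real {x..} t *\<^sub>R (exp (- p * t) * K))"
      using set_integrable_mult_left[of K lborel "{x..}", OF exp_minus_set_integrable[OF assms(1)]]
      by (simp add: set_integrable_def)
    show "AE t in lborel. indicat_real {x..} t *\<^sub>R \<bar>exp (- p * t) * r t\<bar> \<le> indicat_real {x..} t *\<^sub>R (exp (- p * t) * K)"
      using K by eventually_elim (auto simp: indicator_def abs_mult)
  qed
  also have "\<dots> = exp (- p * x) / p * K"
    by (simp only: set_integral_mult_left exp_minus_set_integral[OF assms(1)])
  finally have "exp (p * x) * \<bar>LBINT t:{x..}. exp (- p * t) * r t\<bar> \<le> exp (p * x) * (exp (- p * x) / p * K)"
    by (intro mult_left_mono) auto
  also have "\<dots> = K / p" by (simp add: mult.assoc[symmetric] exp_add[symmetric])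
  finally show ?thesis by (simp add: resolvent_right_def abs_mult)
qed

lemma
  fixes x :: real
  assumes r: "exp_integrable_right p r"
  shows exp_integrable_right_shift: "exp_integrable_right p (\<lambda>s. r (x + s))"
    and resolvent_right_shift: "resolvent_right p (\<lambda>s. r (x + s)) y = resolvent_right p r (x + y)"
proof -
  define f where "f y t = indicator {x + y..} t * (exp (- p * t) * r t)" for y t :: real
  have f: "f y (x + 1 * t) = exp (- p * x) * (indicator {y..} t * (exp (- p * t) * r (x + t)))" for y t
    by (auto simp: f_def indicator_def exp_add[symmetric] algebra_simps)
  have "integrable lborel (f y)" for y
    using r unfolding exp_integrable_right_def set_integrable_def f_def by auto
  then have "integrable lborel (\<lambda>t. f y (x + 1 * t))" for y
    by (subst lborel_integrable_real_affine_iff) auto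
  then show "exp_integrable_right p (\<lambda>s. r (x + s))"
    unfolding f exp_integrable_right_def set_integrable_def by simp
  have "(\<integral>t. f y t \<partial>lborel) = (\<integral>t. f y (x + 1 * t) \<partial>lborel)"
    using lborel_integral_real_affine[of 1 "f y" x] by simp
  then have "(LBINT t:{x + y..}. exp (- p * t) * r t) = exp (- p * x) * (LBINT t:{y..}. exp (- p * t) * r (x + t))"
    unfolding f unfolding f_def set_lebesgue_integral_def by simp
  then show "resolvent_right p (\<lambda>s. r (x + s)) y = resolvent_right p r (x + y)"
    by (simp add: resolvent_right_def mult.assoc[symmetric] exp_add[symmetric] algebra_simps)
qed

lemma
  assumes "exp_integrable_right p r" "exp_integrable_right p s"
  shows exp_integrable_right_diff: "exp_integrable_right p (\<lambda>t. r t - s t)"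
    and resolvent_right_diff: "resolvent_right p (\<lambda>t. r t - s t) x = resolvent_right p r x - resolvent_right p s x"
  using assms
  by (auto simp: exp_integrable_right_def resolvent_right_def right_diff_distrib set_integral_diff)

text \<open>The resolvent commutes with translations, so its increment from \<open>y\<close> to \<open>x\<close> is the resolvent of
\<open>r (x + s) - r (y + s)\<close>, a function bounded by \<open>K \<bar>x - y\<bar>\<close>.\<close>

lemma resolvent_right_lipschitz:
  assumes "p > 0" and r: "exp_integrable_right p r" and K: "K-lipschitz_on UNIV r"
  shows "(K / p)-lipschitz_on UNIV (resolvent_right p r)"
proof (rule lipschitz_onI)
  fix x y :: real
  have "resolvent_right p r x - resolvent_right p r y = resolvent_right p (\<lambda>s. r (x + s) - r (y + s)) 0"
    using r by (simp add: resolvent_right_diff resolvent_right_shift exp_integrable_right_shift)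
  also have "\<bar>\<dots>\<bar> \<le> K * dist x y / p"
  proof (rule resolvent_right_bound)
    show "exp_integrable_right p (\<lambda>s. r (x + s) - r (y + s))"
      using r by (intro exp_integrable_right_diff exp_integrable_right_shift)
    show "AE s in lborel. \<bar>r (x + s) - r (y + s)\<bar> \<le> K * dist x y"
    proof (rule AE_I2)
      fix s show "\<bar>r (x + s) - r (y + s)\<bar> \<le> K * dist x y"
        using lipschitz_onD[OF K, of "x + s" "y + s"] by (simp add: dist_real_def)
    qed
  qed fact
  finally show "dist (resolvent_right p r x) (resolvent_right p r y) \<le> K / p * dist x y"
    by (simp add: dist_real_def)
qed (use assms lipschitz_on_nonneg[OF K] in auto)

text \<open>Integration by parts on \<open>{x..N}\<close>, where the boundary term at \<open>N\<close> vanishes in the limit.\<close>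

lemma resolvent_right_deriv_commute:
  assumes "\<And>x. (r has_real_derivative r' x) (at x)" "continuous_on UNIV r'"
    and int: "exp_integrable_right p r" "exp_integrable_right p r'"
    and lim: "((\<lambda>x. exp (- p * x) * r x) \<longlongrightarrow> 0) at_top"
  shows "resolvent_right p r' x = p * resolvent_right p r x - r x"
proof -
  define f where "f t = exp (- p * t) * r' t - p * (exp (- p * t) * r t)" for t
  have "is_indefinite_integral (\<lambda>t. exp (- p * t) * r t) f"
    unfolding f_def
    using assms(1,2) DERIV_continuous_on[OF DERIV_subset[OF assms(1)]]
    by (intro C1_is_indefinite_integral) (auto intro!: derivative_eq_intros continuous_intros)
  then have fin: "(LBINT t:{x..N}. f t) = exp (- p * N) * r N - exp (- p * x) * r x" if "x \<le> N" for N
    using is_indefinite_integralD(2) that by blast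
  have f: "set_integrable lborel {x..} f"
    "(LBINT t:{x..}. f t) = (LBINT t:{x..}. exp (- p * t) * r' t) - p * (LBINT t:{x..}. exp (- p * t) * r t)"
    using int unfolding f_def exp_integrable_right_def by (auto simp: set_integral_diff)
  have "((\<lambda>N. LBINT t:{x..N}. f t) \<longlongrightarrow> (LBINT t:{x..}. f t)) at_top"
    using f(1) by (intro tendsto_set_lebesgue_integral_at_top) auto
  moreover have "((\<lambda>N. LBINT t:{x..N}. f t) \<longlongrightarrow> 0 - exp (- p * x) * r x) at_top"
    by (rule Lim_transform_eventually[OF tendsto_diff[OF lim tendsto_const]])
      (use eventually_ge_at_top[of x] in \<open>eventually_elim, simp only: fin\<close>)
  ultimately have "(LBINT t:{x..}. f t) = - (exp (- p * x) * r x)"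
    using tendsto_unique[OF trivial_limit_at_top_linorder] by fastforce
  then have "exp (p * x) * (LBINT t:{x..}. exp (- p * t) * r' t) =
      exp (p * x) * (p * (LBINT t:{x..}. exp (- p * t) * r t) - exp (- p * x) * r x)"
    using f(2) by simp
  then show ?thesis
    by (simp add: resolvent_right_def right_diff_distrib mult.assoc[symmetric] exp_add[symmetric] mult.commute[of p])
qed

lemma AE_lborel_reflect:
  assumes "AE x in lborel. P (x :: real)"
  shows "AE x in lborel. P (- x)"
proof -
  obtain N where N: "{x. \<not> P x} \<subseteq> N" "emeasure lborel N = 0" "N \<in> sets borel"
    using AE_E[OF assms] by auto
  have "emeasure lborel (uminus -` N) = emeasure (distr lborel borel uminus) N"
    using N(3) by (simp add: emeasure_distr)
  also have "\<dots> = 0" using N(2) by (simp add: lborel_distr_uminus)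
  finally have "uminus -` N \<in> null_sets lborel"
    using measurable_sets[OF borel_measurable_uminus[OF measurable_ident] N(3)] by (auto simp: null_sets_def)
  then show ?thesis by (rule AE_I') (use N(1) in auto)
qed

lemma resolvent_left_bound:
  assumes "q > 0" and r: "exp_integrable_left q r" and K: "AE x in lborel. \<bar>r x\<bar> \<le> K"
  shows "\<bar>resolvent_left q r x\<bar> \<le> K / q"
  unfolding resolvent_left_reflect
proof (rule resolvent_right_bound)
  show "exp_integrable_right q (\<lambda>t. r (- t))" using r by (simp add: exp_integrable_left_reflect)
  show "AE x in lborel. \<bar>r (- x)\<bar> \<le> K" by (rule AE_lborel_reflect[OF K])
qed fact

lemma resolvent_left_lipschitz:
  assumes "q > 0" and r: "exp_integrable_left q r" and K: "K-lipschitz_on UNIV r"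
  shows "(K / q)-lipschitz_on UNIV (resolvent_left q r)"
proof -
  have reflect: "C-lipschitz_on UNIV (\<lambda>t. g (- t))" if "C-lipschitz_on UNIV g" for C and g :: "real \<Rightarrow> real"
    using that lipschitz_onD[OF that, of "- _" "- _"]
    by (intro lipschitz_onI) (auto simp: dist_minus intro: lipschitz_on_nonneg)
  have "(K / q)-lipschitz_on UNIV (resolvent_right q (\<lambda>t. r (- t)))"
    using assms by (intro resolvent_right_lipschitz reflect) (auto simp: exp_integrable_left_reflect)
  from reflect[OF this] show ?thesis by (simp add: resolvent_left_reflect[abs_def])
qed

lemma resolvent_left_deriv_commute:
  assumes r: "\<And>x. (r has_real_derivative r' x) (at x)" "continuous_on UNIV r'"
    and int: "exp_integrable_left q r" "exp_integrable_left q r'"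
    and lim: "((\<lambda>x. exp (- q * x) * r (- x)) \<longlongrightarrow> 0) at_top"
  shows "resolvent_left q r' x = r x - q * resolvent_left q r x"
proof -
  have int': "exp_integrable_right q (\<lambda>t. r (- t))" "exp_integrable_right q (\<lambda>t. r' (- t))"
    using int by (auto simp: exp_integrable_left_reflect)
  then have int'': "exp_integrable_right q (\<lambda>t. - r' (- t))"
    by (simp add: exp_integrable_right_def set_integrable_def)
  have "resolvent_right q (\<lambda>t. - r' (- t)) (- x) = q * resolvent_right q (\<lambda>t. r (- t)) (- x) - r (- (- x))"
  proof (rule resolvent_right_deriv_commute[where r = "\<lambda>t. r (- t)"])
    show "((\<lambda>t. r (- t)) has_real_derivative - r' (- x)) (at x)" for x
      using DERIV_chain'[OF DERIV_minus[OF DERIV_ident] r(1), of x] by simp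
    show "continuous_on UNIV (\<lambda>t. - r' (- t))"
      by (intro continuous_intros continuous_on_compose2[OF r(2)]) auto
  qed (use int' int'' lim in auto)
  moreover have "resolvent_right q (\<lambda>t. - r' (- t)) (- x) = - resolvent_right q (\<lambda>t. r' (- t)) (- x)"
    by (simp add: resolvent_right_def set_lebesgue_integral_def)
  ultimately show ?thesis by (simp add: resolvent_left_reflect)
qed

section \<open>Functions of subexponential growth\<close>

text \<open>A growth class that contains all Lipschitz functions, is closed under taking antiderivatives, and guarantees both
the integrability against exponential weights and the vanishing of boundary terms. If \<open>h\<^sup>(\<^sup>k\<^sup>)\<close> is
Lipschitz, then \<open>h\<close> and its first \<open>k\<close> derivatives belong to it.\<close>

definition subexponential :: "(real \<Rightarrow> real) \<Rightarrow> bool" where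
  "subexponential g \<longleftrightarrow> (\<forall>m>0. \<exists>A. \<forall>x. \<bar>g x\<bar> \<le> A * exp (m * \<bar>x\<bar>))"

lemma le_exp_div: "y \<le> exp (m * y) / m" if "m > 0" for m y :: real
proof -
  have "m * y \<le> exp (m * y)" using exp_ge_add_one_self[of "m * y"] by linarith
  then show ?thesis using that by (simp add: field_simps)
qed

lemma lipschitz_subexponential:
  assumes K: "K-lipschitz_on UNIV g"
  shows "subexponential g"
  unfolding subexponential_def
proof (intro allI impI exI)
  fix m x :: real assume "m > 0"
  have "\<bar>g x\<bar> \<le> \<bar>g 0\<bar> + K * \<bar>x\<bar>"
    using lipschitz_onD[OF K, of x 0] by (auto simp: dist_real_def)
  also have "\<dots> \<le> \<bar>g 0\<bar> * exp (m * \<bar>x\<bar>) + K * (exp (m * \<bar>x\<bar>) / m)"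
    using \<open>m > 0\<close> lipschitz_on_nonneg[OF K] by (intro add_mono mult_left_mono le_exp_div mult_right_le_one_le[THEN order_trans]) (auto simp: mult_le_cancel_left1)
  finally show "\<bar>g x\<bar> \<le> (\<bar>g 0\<bar> + K / m) * exp (m * \<bar>x\<bar>)" by (simp add: algebra_simps)
qed

text \<open>By the mean value theorem \<open>g\<close> gains at most a factor \<open>\<bar>x\<bar>\<close>, which is absorbed by using half of the exponent for
the derivative.\<close>

lemma subexponential_antiderivative:
  assumes g: "\<And>x. (g has_real_derivative g' x) (at x)" and sub: "subexponential g'"
  shows "subexponential g"
  unfolding subexponential_def
proof (intro allI impI)
  fix m :: real assume "m > 0"
  then obtain A where A: "\<And>x. \<bar>g' x\<bar> \<le> A * exp (m / 2 * \<bar>x\<bar>)"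
    using sub half_gt_zero unfolding subexponential_def by metis
  have A0: "A \<ge> 0" using order_trans[OF abs_ge_zero A[of 0]] by simp
  have "\<bar>g x\<bar> \<le> (\<bar>g 0\<bar> + A * (2 / m)) * exp (m * \<bar>x\<bar>)" for x
  proof -
    have "\<bar>g x - g 0\<bar> \<le> A * exp (m / 2 * \<bar>x\<bar>) * \<bar>x - 0\<bar>"
    proof (rule field_differentiable_bound[of "{min 0 x..max 0 x}" g g', unfolded real_norm_def])
      show "(g has_field_derivative g' z) (at z within {min 0 x..max 0 x})" for z
        by (rule DERIV_subset[OF g]) simp
      show "\<bar>g' z\<bar> \<le> A * exp (m / 2 * \<bar>x\<bar>)" if "z \<in> {min 0 x..max 0 x}" for z
      proof -
        have "\<bar>z\<bar> \<le> \<bar>x\<bar>" using that by (auto simp: min_def max_def split: if_splits)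
        then show ?thesis
          using A0 \<open>m > 0\<close> by (intro order_trans[OF A] mult_left_mono) auto
      qed
    qed auto
    then have "\<bar>g x\<bar> \<le> \<bar>g 0\<bar> + A * exp (m / 2 * \<bar>x\<bar>) * \<bar>x\<bar>" by simp
    also have "\<dots> \<le> \<bar>g 0\<bar> * exp (m * \<bar>x\<bar>) + A * exp (m / 2 * \<bar>x\<bar>) * (exp (m / 2 * \<bar>x\<bar>) / (m / 2))"
      using A0 \<open>m > 0\<close> by (intro add_mono mult_left_mono le_exp_div) (auto simp: mult_le_cancel_left1)
    also have "\<dots> = (\<bar>g 0\<bar> + A * (2 / m)) * exp (m * \<bar>x\<bar>)"
      using \<open>m > 0\<close> by (simp add: algebra_simps exp_add[symmetric])
    finally show ?thesis .
  qed
  then show "\<exists>A. \<forall>x. \<bar>g x\<bar> \<le> A * exp (m * \<bar>x\<bar>)" by blast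
qed

lemma subexponential_reflect: "subexponential g \<Longrightarrow> subexponential (\<lambda>t. g (- t))"
  unfolding subexponential_def by (metis abs_minus_cancel)

lemma subexponential_exp_integrable_right:
  assumes "p > 0" "subexponential g" and [measurable]: "g \<in> borel_measurable borel"
  shows "exp_integrable_right p g"
  unfolding exp_integrable_right_def
proof
  fix x :: real
  obtain A where A: "\<And>t. \<bar>g t\<bar> \<le> A * exp (p / 2 * \<bar>t\<bar>)"
    using assms(1,2) half_gt_zero unfolding subexponential_def by metis
  have A0: "A \<ge> 0" using order_trans[OF abs_ge_zero A[of 0]] by simp
  have "set_integrable lborel {x..} (\<lambda>t. A * exp (p * \<bar>x\<bar>) * exp (- (p / 2) * t))"
    using assms(1) by (intro set_integrable_mult_right exp_minus_set_integrable) auto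
  then show "set_integrable lborel {x..} (\<lambda>t. exp (- p * t) * g t)"
    unfolding set_integrable_def
  proof (rule Bochner_Integration.integrable_bound)
    show "AE t in lborel. norm (indicator {x..} t *\<^sub>R (exp (- p * t) * g t)) \<le>
        norm (indicator {x..} t *\<^sub>R (A * exp (p * \<bar>x\<bar>) * exp (- (p / 2) * t)))"
    proof (intro AE_I2)
      fix t
      show "norm (indicator {x..} t *\<^sub>R (exp (- p * t) * g t)) \<le>
          norm (indicator {x..} t *\<^sub>R (A * exp (p * \<bar>x\<bar>) * exp (- (p / 2) * t)))"
      proof (cases "x \<le> t")
        case True
        then have "p * \<bar>t\<bar> \<le> p * (t + 2 * \<bar>x\<bar>)" using \<open>p > 0\<close> by (intro mult_left_mono) auto
        then have le: "- p * t + p / 2 * \<bar>t\<bar> \<le> p * \<bar>x\<bar> + - (p / 2) * t" by (simp add: algebra_simps)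
        have "exp (- p * t) * \<bar>g t\<bar> \<le> exp (- p * t) * (A * exp (p / 2 * \<bar>t\<bar>))"
          by (intro mult_left_mono A) auto
        also have "\<dots> = A * exp (- p * t + p / 2 * \<bar>t\<bar>)" by (simp only: exp_add) simp
        also have "\<dots> \<le> A * exp (p * \<bar>x\<bar> + - (p / 2) * t)" using le A0 by (intro mult_left_mono) auto
        also have "\<dots> = A * exp (p * \<bar>x\<bar>) * exp (- (p / 2) * t)" by (simp only: exp_add mult.assoc)
        finally show ?thesis using True A0 by (simp add: abs_mult)
      qed simp
    qed
  qed measurable
qed

lemma subexponential_exp_integrable_left:
  assumes "q > 0" "subexponential g" and [measurable]: "g \<in> borel_measurable borel"
  shows "exp_integrable_left q g"
  unfolding exp_integrable_left_reflect
  using assms by (intro subexponential_exp_integrable_right subexponential_reflect) auto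

lemma subexponential_limit:
  assumes "p > 0" "subexponential g"
  shows "((\<lambda>x. exp (- p * x) * g x) \<longlongrightarrow> 0) at_top"
proof -
  obtain A where A: "\<And>t. \<bar>g t\<bar> \<le> A * exp (p / 2 * \<bar>t\<bar>)"
    using assms(1,2) half_gt_zero unfolding subexponential_def by metis
  have "((\<lambda>x. A * exp (- (p / 2) * x)) \<longlongrightarrow> 0) at_top"
    using \<open>p > 0\<close> by real_asymp
  then show ?thesis
  proof (rule Lim_null_comparison[rotated])
    show "eventually (\<lambda>x. norm (exp (- p * x) * g x) \<le> A * exp (- (p / 2) * x)) at_top"
      using eventually_ge_at_top[of 0]
    proof eventually_elim
      case (elim x)
      have "exp (- p * x) * \<bar>g x\<bar> \<le> exp (- p * x) * (A * exp (p / 2 * \<bar>x\<bar>))"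
        by (intro mult_left_mono A) auto
      also have "\<dots> = A * exp (- p * x + p / 2 * x)" using elim by (simp only: exp_add) simp
      also have "- p * x + p / 2 * x = - (p / 2) * x" by (simp add: field_simps)
      finally show ?case by (simp add: abs_mult)
    qed
  qed
qed

section \<open>Uniqueness of the bounded solution\<close>

text \<open>Uses \<open>exp (p x) \<ge> 1 + p x\<close> at a point \<open>x\<close> where \<open>\<bar>u\<bar> (1 + p x)\<close> equals \<open>\<bar>u\<bar> + M\<close>.\<close>

lemma exp_growth_zero:
  fixes u p M :: real
  assumes "p > 0" "\<And>x. x \<ge> 0 \<Longrightarrow> \<bar>u\<bar> * exp (p * x) \<le> M"
  shows "u = 0"
proof (rule ccontr)
  assume "u \<noteq> 0"
  have M: "M \<ge> 0" using assms(2)[of 0] by (auto intro: order_trans[OF abs_ge_zero])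
  define x where "x = M / (\<bar>u\<bar> * p)"
  have "x \<ge> 0" using M \<open>p > 0\<close> by (simp add: x_def)
  have "\<bar>u\<bar> * (1 + p * x) \<le> \<bar>u\<bar> * exp (p * x)"
    by (intro mult_left_mono exp_ge_add_one_self) auto
  also have "\<dots> \<le> M" by (rule assms(2)[OF \<open>x \<ge> 0\<close>])
  also have "\<bar>u\<bar> * (1 + p * x) = \<bar>u\<bar> + M" using \<open>u \<noteq> 0\<close> \<open>p > 0\<close> by (simp add: x_def field_simps)
  finally show False using \<open>u \<noteq> 0\<close> by simp
qed

lemma first_order_linear_ode:
  fixes u :: "real \<Rightarrow> real"
  assumes "\<And>x. (u has_real_derivative c * u x) (at x)"
  shows "u x = u 0 * exp (c * x)"
proof -
  have "((\<lambda>x. exp (- c * x) * u x) has_real_derivative 0) (at x)" for x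
    by (rule derivative_eq_intros assms refl | simp add: algebra_simps)+
  from DERIV_isconst_all[OF allI[OF this], of x 0]
  have "exp (c * x) * (exp (- c * x) * u x) = exp (c * x) * u 0" by simp
  moreover have "exp (c * x) * (exp (- c * x) * u x) = u x"
    by (simp add: mult.assoc[symmetric] exp_add[symmetric])
  ultimately show ?thesis by (simp only: mult.commute)
qed

text \<open>The derivative of the difference \<open>w = f - g\<close> is the integral of a continuous function, because the inhomogeneity
cancels. So \<open>w\<close> is a classical solution of the homogeneous equation, and factoring the operator makes
\<open>w' + q w\<close> a multiple of \<open>exp (p x)\<close> and \<open>w' - p w\<close> a multiple of \<open>exp (- q x)\<close>. Boundedness of \<open>w\<close>
forces both multiples to vanish.\<close>

lemma bounded_solution_unique:
  fixes p q :: real and f g s :: "real \<Rightarrow> real"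
  assumes p: "p > 0" and q: "q > 0"
    and f: "\<And>x. f differentiable (at x)" "loc_abs_cont (deriv f)"
      "AE x in lebesgue. (deriv f has_real_derivative s x + p * q * f x - (q - p) * deriv f x) (at x)"
      "bounded (range f)"
    and g: "\<And>x. g differentiable (at x)" "loc_abs_cont (deriv g)"
      "AE x in lebesgue. (deriv g has_real_derivative s x + p * q * g x - (q - p) * deriv g x) (at x)"
      "bounded (range g)"
  shows "f = g"
proof -
  define w where "w x = f x - g x" for x
  define v where "v x = deriv f x - deriv g x" for x
  have w: "(w has_real_derivative v x) (at x)" for x
    unfolding w_def v_def using f(1)[of x] g(1)[of x]
    by (intro DERIV_diff) (simp_all add: DERIV_deriv_iff_real_differentiable)
  have "((\<lambda>x. p * q * w x - (q - p) * v x) has_integral (v d - v c)) {c..d}" if "c \<le> d" for c d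
  proof -
    have "((\<lambda>x. (s x + p * q * f x - (q - p) * deriv f x) - (s x + p * q * g x - (q - p) * deriv g x))
        has_integral ((deriv f d - deriv f c) - (deriv g d - deriv g c))) {c..d}"
      using f(2,3) g(2,3) that
      by (intro has_integral_diff AE_derivative_has_integral) (auto simp: loc_abs_cont_def)
    then show ?thesis by (simp add: w_def v_def algebra_simps)
  qed
  moreover have "continuous_on UNIV (\<lambda>x. p * q * w x - (q - p) * v x)"
    using DERIV_continuous_on[OF DERIV_subset[OF w]] loc_abs_cont_continuous[OF f(2)] loc_abs_cont_continuous[OF g(2)]
    unfolding v_def by (intro continuous_intros) auto
  ultimately have v: "(v has_real_derivative p * q * w x - (q - p) * v x) (at x)" for x
    by (rule has_integral_derivative)
  \<comment> \<open>\<open>u\<close> and \<open>z\<close> are the images of \<open>w\<close> under \<open>D + q\<close> and \<open>D - p\<close>.\<close>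
  define u where "u x = v x + q * w x" for x
  define z where "z x = v x - p * w x" for x
  have u: "u x = u 0 * exp (p * x)" for x
  proof (rule first_order_linear_ode)
    show "(u has_real_derivative p * u x) (at x)" for x
      unfolding u_def by (rule derivative_eq_intros v w refl | simp add: algebra_simps)+
  qed
  have z: "z x = z 0 * exp ((- q) * x)" for x
  proof (rule first_order_linear_ode)
    show "(z has_real_derivative (- q) * z x) (at x)" for x
      unfolding z_def by (rule derivative_eq_intros v w refl | simp add: algebra_simps)+
  qed
  have uz: "u x - z x = (p + q) * w x" for x by (simp add: u_def z_def algebra_simps)
  obtain F G where FG: "\<And>x. \<bar>f x\<bar> \<le> F" "\<And>x. \<bar>g x\<bar> \<le> G"
    using f(4) g(4) unfolding bounded_iff by auto
  define M where "M = (p + q) * (F + G)"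
  have M: "\<bar>(p + q) * w x\<bar> \<le> M" for x
  proof -
    have "\<bar>w x\<bar> \<le> F + G" unfolding w_def using FG[of x] by linarith
    then show ?thesis using p q by (simp add: M_def abs_mult)
  qed
  have "u 0 = 0"
  proof (rule exp_growth_zero[OF p])
    fix x :: real assume "x \<ge> 0"
    then have "\<bar>z x\<bar> \<le> \<bar>z 0\<bar>" unfolding z[of x] using q by (simp add: abs_mult mult_left_le)
    then have "\<bar>u x\<bar> \<le> M + \<bar>z 0\<bar>" using uz[of x] M[of x] by linarith
    then show "\<bar>u 0\<bar> * exp (p * x) \<le> M + \<bar>z 0\<bar>" unfolding u[of x] by (simp add: abs_mult)
  qed
  moreover have "z 0 = 0"
  proof (rule exp_growth_zero[OF q])
    fix x :: real assume "x \<ge> 0"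
    then have "\<bar>u (- x)\<bar> \<le> \<bar>u 0\<bar>" unfolding u[of "- x"] using p by (simp add: abs_mult mult_left_le)
    then have "\<bar>z (- x)\<bar> \<le> M + \<bar>u 0\<bar>" using uz[of "- x"] M[of "- x"] by linarith
    then show "\<bar>z 0\<bar> * exp (q * x) \<le> M + \<bar>u 0\<bar>" unfolding z[of "- x"] by (simp add: abs_mult)
  qed
  ultimately have "(p + q) * w x = 0" for x using uz[of x] u[of x] z[of x] by simp
  then have "w x = 0" for x using p q by (metis add_pos_pos mult_eq_0_iff less_numeral_extra(3))
  then show ?thesis by (simp add: w_def fun_eq_iff)
qed

section \<open>The Green operator of the constant-coefficient equation\<close>

text \<open>The solution operator of \<open>f'' + (q - p) f' - p q f = p q r\<close>. The next two functions are formulas for the first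
two derivatives of the solution. They are linear in \<open>r\<close> and its resolvents, and this is what makes estimates
immediate.\<close>

definition green_sol :: "real \<Rightarrow> real \<Rightarrow> (real \<Rightarrow> real) \<Rightarrow> real \<Rightarrow> real" where
  "green_sol p q r x = - (p * q / (p + q)) * (resolvent_right p r x + resolvent_left q r x)"

definition green_slope :: "real \<Rightarrow> real \<Rightarrow> (real \<Rightarrow> real) \<Rightarrow> real \<Rightarrow> real" where
  "green_slope p q r x = - (p * q / (p + q)) * (p * resolvent_right p r x - q * resolvent_left q r x)"

definition green_curv :: "real \<Rightarrow> real \<Rightarrow> (real \<Rightarrow> real) \<Rightarrow> real \<Rightarrow> real" where
  "green_curv p q r x = p * q * r x
     - p * q / (p + q) * (p\<^sup>2 * resolvent_right p r x + q\<^sup>2 * resolvent_left q r x)"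

lemma green_const:
  fixes p q :: real
  assumes "p > 0" "q > 0"
  shows "p * q / (p + q) > 0" "p * q / (p + q) * (1 / p + 1 / q) = 1" "p * q / (p + q) * (p + q) = p * q"
proof -
  have "p + q > 0" using assms by linarith
  then show *: "p * q / (p + q) > 0" "p * q / (p + q) * (p + q) = p * q" using assms by auto
  have "1 / p + 1 / q = (p + q) / (p * q)" using assms by (simp add: field_simps)
  then show "p * q / (p + q) * (1 / p + 1 / q) = 1" using assms \<open>p + q > 0\<close> by simp
qed

text \<open>The equation holds at every point as an identity between the formulas; only the identification of
\<open>green_curv\<close> with the second derivative is restricted to almost every point.\<close>

lemma green_ode:
  "green_curv p q r x + (q - p) * green_slope p q r x - p * q * green_sol p q r x = p * q * r x"
proof -
  define c where "c = p * q / (p + q)"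
  show ?thesis
    unfolding green_sol_def green_slope_def green_curv_def c_def[symmetric]
    by (simp add: algebra_simps power2_eq_square)
qed

context
  fixes p q :: real and r :: "real \<Rightarrow> real"
  assumes p: "p > 0" and q: "q > 0"
    and int_right: "exp_integrable_right p r" and int_left: "exp_integrable_left q r"
begin

lemma green_sol_loc_abs_cont: "loc_abs_cont (green_sol p q r)"
  unfolding green_sol_def[abs_def]
  by (intro loc_abs_cont_cmult loc_abs_cont_add resolvent_right_loc_abs_cont resolvent_left_loc_abs_cont
      int_right int_left)

lemma green_slope_loc_abs_cont: "loc_abs_cont (green_slope p q r)"
proof -
  have "loc_abs_cont (\<lambda>x. - (p * q / (p + q)) * (p * resolvent_right p r x + (- q) * resolvent_left q r x))"
    by (intro loc_abs_cont_cmult loc_abs_cont_add resolvent_right_loc_abs_cont resolvent_left_loc_abs_cont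
      int_right int_left)
  then show ?thesis unfolding green_slope_def[abs_def] by simp
qed

text \<open>The contributions of \<open>r\<close> to the derivatives of the two resolvents cancel, so the derivative, known almost
everywhere, is continuous and hence is the derivative everywhere.\<close>

lemma green_sol_derivative: "(green_sol p q r has_real_derivative green_slope p q r x) (at x)"
proof (rule loc_abs_cont_derivative[OF green_sol_loc_abs_cont])
  show "AE x in lebesgue. (green_sol p q r has_real_derivative green_slope p q r x) (at x)"
    using resolvent_right_AE_derivative[OF int_right] resolvent_left_AE_derivative[OF int_left]
  proof eventually_elim
    case (elim x)
    from DERIV_cmult[OF DERIV_add[OF elim], of "- (p * q / (p + q))"]
    show ?case unfolding green_sol_def[abs_def] green_slope_def by (simp add: algebra_simps)
  qed
qed (rule loc_abs_cont_continuous[OF green_slope_loc_abs_cont])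

lemma deriv_green_sol: "deriv (green_sol p q r) = green_slope p q r"
  using DERIV_imp_deriv[OF green_sol_derivative] by (simp add: fun_eq_iff)

lemma green_curv_eq:
  "- (p * q / (p + q)) * (p * (p * resolvent_right p r x - r x) - q * (r x - q * resolvent_left q r x))
     = green_curv p q r x"
  using p q by (simp add: green_curv_def field_simps power2_eq_square)

lemma green_slope_AE_derivative:
  "AE x in lebesgue. (green_slope p q r has_real_derivative green_curv p q r x) (at x)"
  using resolvent_right_AE_derivative[OF int_right] resolvent_left_AE_derivative[OF int_left]
proof eventually_elim
  case (elim x)
  from DERIV_cmult[OF DERIV_diff[OF DERIV_cmult[OF elim(1), of p] DERIV_cmult[OF elim(2), of q]],
      of "- (p * q / (p + q))"]
  show ?case unfolding green_slope_def[abs_def] green_curv_eq[symmetric] .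
qed

lemma green_slope_derivative:
  assumes "continuous_on UNIV r"
  shows "(green_slope p q r has_real_derivative green_curv p q r x) (at x)"
proof (rule loc_abs_cont_derivative[OF green_slope_loc_abs_cont green_slope_AE_derivative])
  show "continuous_on UNIV (green_curv p q r)"
    unfolding green_curv_def[abs_def]
    by (intro continuous_intros assms loc_abs_cont_continuous resolvent_right_loc_abs_cont
        resolvent_left_loc_abs_cont int_right int_left)
qed

text \<open>With \<open>c = p q/(p + q)\<close> these use \<open>c (1/p + 1/q) = 1\<close> for the solution, \<open>p \<bar>R\<bar> \<le> K\<close> and \<open>q \<bar>L\<bar> \<le> K\<close> for the
slope, and \<open>c (p + q) = p q\<close> for the second derivative.\<close>

lemma green_bounds:
  assumes K: "AE x in lborel. \<bar>r x\<bar> \<le> K"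
  shows "\<bar>green_sol p q r x\<bar> \<le> K"
    and "\<bar>green_slope p q r x\<bar> \<le> 2 * (p * q / (p + q)) * K"
    and "\<bar>green_curv p q r x\<bar> \<le> p * q * \<bar>r x\<bar> + p * q * K"
proof -
  define c where "c = p * q / (p + q)"
  define R where "R = resolvent_right p r x"
  define L where "L = resolvent_left q r x"
  have c: "c > 0" "c * (1 / p + 1 / q) = 1" "c * (p + q) = p * q"
    unfolding c_def by (rule green_const[OF p q])+
  have R: "\<bar>R\<bar> \<le> K / p" and L: "\<bar>L\<bar> \<le> K / q"
    unfolding R_def L_def using resolvent_right_bound[OF p int_right K] resolvent_left_bound[OF q int_left K] by auto
  have "\<bar>R + L\<bar> \<le> K / p + K / q" using R L by linarith
  then have "c * \<bar>R + L\<bar> \<le> c * (K / p + K / q)" using c by (intro mult_left_mono) auto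
  also have "\<dots> = K * (c * (1 / p + 1 / q))" by (simp add: algebra_simps)
  finally show "\<bar>green_sol p q r x\<bar> \<le> K"
    using c by (simp add: green_sol_def c_def[symmetric] R_def L_def abs_mult)
  have pR: "\<bar>p * R\<bar> \<le> K" and qL: "\<bar>q * L\<bar> \<le> K"
    using R L p q by (auto simp: abs_mult field_simps)
  then have "\<bar>p * R - q * L\<bar> \<le> 2 * K" by linarith
  then have "c * \<bar>p * R - q * L\<bar> \<le> c * (2 * K)" using c by (intro mult_left_mono) auto
  then show "\<bar>green_slope p q r x\<bar> \<le> 2 * (p * q / (p + q)) * K"
    using c by (simp add: green_slope_def c_def[symmetric] R_def L_def abs_mult)
  have "\<bar>p * (p * R) + q * (q * L)\<bar> \<le> \<bar>p * (p * R)\<bar> + \<bar>q * (q * L)\<bar>" by linarith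
  also have "\<dots> \<le> p * K + q * K"
    unfolding abs_mult[of p "p * R"] abs_mult[of q "q * L"] using pR qL p q
    by (intro add_mono mult_mono) auto
  finally have "c * \<bar>p * (p * R) + q * (q * L)\<bar> \<le> c * (p * K + q * K)" using c by (intro mult_left_mono) auto
  also have "\<dots> = c * (p + q) * K" by (simp add: algebra_simps)
  also have "\<dots> = p * q * K" unfolding c(3) ..
  finally have "\<bar>c * (p\<^sup>2 * R + q\<^sup>2 * L)\<bar> \<le> p * q * K"
    using c by (simp add: abs_mult power2_eq_square mult.assoc)
  moreover have "\<bar>p * q * r x\<bar> = p * q * \<bar>r x\<bar>" using p q by (simp add: abs_mult)
  ultimately show "\<bar>green_curv p q r x\<bar> \<le> p * q * \<bar>r x\<bar> + p * q * K"
    unfolding green_curv_def c_def[symmetric] R_def[symmetric] L_def[symmetric] by linarith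
qed

text \<open>The computation of \<open>green_bounds\<close> with Lipschitz constants in place of suprema. The last constant bounds the
third derivative of the solution.\<close>

lemma green_lipschitz:
  assumes K: "K-lipschitz_on UNIV r"
  shows "K-lipschitz_on UNIV (green_sol p q r)"
    and "(2 * (p * q / (p + q)) * K)-lipschitz_on UNIV (green_slope p q r)"
    and "(2 * p * q * K)-lipschitz_on UNIV (green_curv p q r)"
proof -
  define c where "c = p * q / (p + q)"
  have c: "c > 0" "c * (1 / p + 1 / q) = 1" "c * (p + q) = p * q"
    unfolding c_def by (rule green_const[OF p q])+
  note R = resolvent_right_lipschitz[OF p int_right K]
  note L = resolvent_left_lipschitz[OF q int_left K]
  have K0: "K \<ge> 0" using lipschitz_on_nonneg[OF K] .
  have "(\<bar>- c\<bar> * (K / p + K / q))-lipschitz_on UNIV (\<lambda>x. - c * (resolvent_right p r x + resolvent_left q r x))"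
    by (intro lipschitz_on_cmult_real lipschitz_on_add R L)
  moreover have "\<bar>- c\<bar> * (K / p + K / q) = K * (c * (1 / p + 1 / q))" using c(1) by (simp add: algebra_simps)
  ultimately show "K-lipschitz_on UNIV (green_sol p q r)"
    unfolding green_sol_def[abs_def] c_def[symmetric] using c(2) by simp
  have "(\<bar>- c\<bar> * (\<bar>p\<bar> * (K / p) + \<bar>q\<bar> * (K / q)))-lipschitz_on UNIV
      (\<lambda>x. - c * (p * resolvent_right p r x - q * resolvent_left q r x))"
    by (intro lipschitz_on_cmult_real lipschitz_on_diff R L)
  moreover have "\<bar>- c\<bar> * (\<bar>p\<bar> * (K / p) + \<bar>q\<bar> * (K / q)) = 2 * c * K" using c p q by simp
  ultimately show "(2 * (p * q / (p + q)) * K)-lipschitz_on UNIV (green_slope p q r)"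
    unfolding green_slope_def[abs_def] c_def[symmetric] by simp
  have "(\<bar>p * q\<bar> * K + \<bar>c\<bar> * (\<bar>p\<^sup>2\<bar> * (K / p) + \<bar>q\<^sup>2\<bar> * (K / q)))-lipschitz_on UNIV
      (\<lambda>x. p * q * r x - c * (p\<^sup>2 * resolvent_right p r x + q\<^sup>2 * resolvent_left q r x))"
    by (intro lipschitz_on_diff lipschitz_on_cmult_real lipschitz_on_add R L K)
  moreover have "\<bar>p * q\<bar> * K + \<bar>c\<bar> * (\<bar>p\<^sup>2\<bar> * (K / p) + \<bar>q\<^sup>2\<bar> * (K / q)) = p * q * K + c * (p + q) * K"
    using c(1) p q by (simp add: algebra_simps power2_eq_square)
  moreover have "p * q * K + c * (p + q) * K = 2 * p * q * K" unfolding c(3) by simp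
  ultimately show "(2 * p * q * K)-lipschitz_on UNIV (green_curv p q r)"
    unfolding green_curv_def[abs_def] c_def[symmetric] by simp
qed

end

text \<open>The solution operator commutes with differentiation: the terms \<open>- r\<close> and \<open>+ r\<close> from the two integrations by
parts cancel.\<close>

lemma green_slope_eq_green_sol_deriv:
  assumes p: "p > 0" and q: "q > 0"
    and r: "\<And>x. (r has_real_derivative r' x) (at x)" "continuous_on UNIV r'" "subexponential r'"
  shows "green_slope p q r = green_sol p q r'"
proof
  fix x
  have r_cont: "continuous_on UNIV r" by (rule DERIV_continuous_on[OF DERIV_subset[OF r(1)]]) simp
  have sub: "subexponential r" by (rule subexponential_antiderivative[OF r(1,3)])
  note meas = borel_measurable_continuous_onI[OF r_cont] borel_measurable_continuous_onI[OF r(2)]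
  have "resolvent_right p r' x = p * resolvent_right p r x - r x"
    using p r sub meas
    by (intro resolvent_right_deriv_commute subexponential_exp_integrable_right subexponential_limit)
  moreover have "resolvent_left q r' x = r x - q * resolvent_left q r x"
    using q r sub meas
    by (intro resolvent_left_deriv_commute subexponential_exp_integrable_left subexponential_limit subexponential_reflect)
  ultimately show "green_slope p q r x = green_sol p q r' x"
    by (simp add: green_slope_def green_sol_def)
qed

text \<open>Downward induction on the order of the derivative, since growth bounds pass from a function to its
antiderivative.\<close>

lemma iterated_deriv_regularity:
  assumes diff: "\<And>j x. j < k \<Longrightarrow> (deriv ^^ j) r differentiable (at x)"
    and K: "K-lipschitz_on UNIV ((deriv ^^ k) r)" and "j \<le> k"
  shows "continuous_on UNIV ((deriv ^^ j) r)" "subexponential ((deriv ^^ j) r)"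
proof -
  have "continuous_on UNIV ((deriv ^^ j) r) \<and> subexponential ((deriv ^^ j) r)"
    using \<open>j \<le> k\<close>
  proof (induction j rule: inc_induct)
    case base
    show ?case using lipschitz_on_continuous_on[OF K] lipschitz_subexponential[OF K] by simp
  next
    case (step n)
    have D: "((deriv ^^ n) r has_real_derivative (deriv ^^ Suc n) r x) (at x)" for x
      using diff[OF step(2), of x] by (simp add: DERIV_deriv_iff_real_differentiable)
    have "continuous_on UNIV ((deriv ^^ n) r)"
      by (rule DERIV_continuous_on[OF DERIV_subset[OF D]]) simp
    then show ?case using subexponential_antiderivative[OF D] step by blast
  qed
  then show "continuous_on UNIV ((deriv ^^ j) r)" "subexponential ((deriv ^^ j) r)" by auto
qed

lemma iterated_deriv_green_sol:
  assumes p: "p > 0" and q: "q > 0"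
    and diff: "\<And>j x. j < k \<Longrightarrow> (deriv ^^ j) r differentiable (at x)"
    and K: "K-lipschitz_on UNIV ((deriv ^^ k) r)" and "j \<le> k"
  shows "(deriv ^^ j) (green_sol p q r) = green_sol p q ((deriv ^^ j) r)"
  using \<open>j \<le> k\<close>
proof (induction j)
  case (Suc j)
  note reg = iterated_deriv_regularity[OF diff K]
  have int: "exp_integrable_right p ((deriv ^^ j) r)" "exp_integrable_left q ((deriv ^^ j) r)"
    using Suc reg[of j] p q borel_measurable_continuous_onI[OF reg(1)[of j]]
    by (auto intro: subexponential_exp_integrable_right subexponential_exp_integrable_left)
  have "(deriv ^^ Suc j) (green_sol p q r) = deriv (green_sol p q ((deriv ^^ j) r))"
    using Suc by simp
  also have "\<dots> = green_slope p q ((deriv ^^ j) r)"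
    by (rule deriv_green_sol[OF p q int])
  also have "\<dots> = green_sol p q ((deriv ^^ Suc j) r)"
  proof (rule green_slope_eq_green_sol_deriv[OF p q])
    show "((deriv ^^ j) r has_real_derivative (deriv ^^ Suc j) r x) (at x)" for x
      using diff[of j x] Suc by (simp add: DERIV_deriv_iff_real_differentiable)
  qed (use reg[of "Suc j"] Suc in auto)
  finally show ?case .
qed simp

text \<open>The derivative of order \<open>k\<close> of the solution is the solution for the Lipschitz function \<open>r\<^sup>(\<^sup>k\<^sup>)\<close>. Its
essential derivative bound is a Lipschitz constant, to which \<open>green_lipschitz\<close> applies.\<close>

lemma green_sol_lipschitz_derivatives:
  assumes p: "p > 0" and q: "q > 0"
    and diff: "\<And>j x. j < k \<Longrightarrow> (deriv ^^ j) r differentiable (at x)"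
    and L: "L-lipschitz_on UNIV ((deriv ^^ k) r)"
  shows "\<forall>j\<le>k + 1. \<forall>x. (deriv ^^ j) (green_sol p q r) differentiable (at x)"
    and "AE x in lebesgue. (deriv ^^ (k + 2)) (green_sol p q r) differentiable (at x)"
    and "ess_norm ((deriv ^^ (k + 1)) (green_sol p q r)) \<le> ess_norm ((deriv ^^ (k + 1)) r)"
    and "ess_norm ((deriv ^^ (k + 2)) (green_sol p q r))
      \<le> ereal (2 * (p * q / (p + q))) * ess_norm ((deriv ^^ (k + 1)) r)"
    and "ess_norm ((deriv ^^ (k + 3)) (green_sol p q r))
      \<le> ereal (2 * p * q) * ess_norm ((deriv ^^ (k + 1)) r)"
proof -
  have reg: "continuous_on UNIV ((deriv ^^ j) r)"
    and int: "exp_integrable_right p ((deriv ^^ j) r)" "exp_integrable_left q ((deriv ^^ j) r)"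
    if "j \<le> k" for j
  proof -
    show c: "continuous_on UNIV ((deriv ^^ j) r)" by (rule iterated_deriv_regularity[OF diff L that])
    note sub = iterated_deriv_regularity(2)[OF diff L that]
    show "exp_integrable_right p ((deriv ^^ j) r)" "exp_integrable_left q ((deriv ^^ j) r)"
      using p q sub borel_measurable_continuous_onI[OF c]
      by (auto intro: subexponential_exp_integrable_right subexponential_exp_integrable_left)
  qed
  define H where "H = (deriv ^^ k) r"
  note intH = int[of k, folded H_def, simplified]
  have H_cont: "continuous_on UNIV H" using reg[of k] by (simp add: H_def)
  have G: "(deriv ^^ j) (green_sol p q r) = green_sol p q ((deriv ^^ j) r)" if "j \<le> k" for j
    by (rule iterated_deriv_green_sol[OF p q diff L that])
  have G0: "(deriv ^^ k) (green_sol p q r) = green_sol p q H" by (simp add: G H_def)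
  have G1: "(deriv ^^ (k + 1)) (green_sol p q r) = green_slope p q H"
    using deriv_green_sol[OF p q intH] by (simp add: G0)
  have "deriv (green_slope p q H) = green_curv p q H"
    using DERIV_imp_deriv[OF green_slope_derivative[OF p q intH H_cont]] by (simp add: fun_eq_iff)
  then have G2: "(deriv ^^ (k + 2)) (green_sol p q r) = green_curv p q H"
    using G1 by (simp add: eval_nat_numeral)
  obtain K where K: "ess_norm (deriv H) = ereal K" "K-lipschitz_on UNIV H"
    using lipschitz_ess_norm_deriv[OF L] unfolding H_def by blast
  have H1: "(deriv ^^ (k + 1)) r = deriv H" by (simp add: H_def)
  note lip = green_lipschitz[OF p q intH K(2)]
  show "\<forall>j\<le>k + 1. \<forall>x. (deriv ^^ j) (green_sol p q r) differentiable (at x)"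
  proof (intro allI impI)
    fix j x assume "j \<le> k + 1"
    then consider "j \<le> k" | "j = k + 1" by linarith
    then show "(deriv ^^ j) (green_sol p q r) differentiable (at x)"
    proof cases
      case 1
      then show ?thesis
        using green_sol_derivative[OF p q int(1,2)[OF 1], of x] unfolding G[OF 1] real_differentiable_def by blast
    next
      case 2
      then show ?thesis
        using green_slope_derivative[OF p q intH H_cont, of x] G1 unfolding real_differentiable_def by auto
    qed
  qed
  show "AE x in lebesgue. (deriv ^^ (k + 2)) (green_sol p q r) differentiable (at x)"
    unfolding G2 by (rule lipschitz_AE_differentiable[OF lip(3)])
  show "ess_norm ((deriv ^^ (k + 1)) (green_sol p q r)) \<le> ess_norm ((deriv ^^ (k + 1)) r)"
    using lipschitz_ess_norm_deriv_le[OF lip(1)] unfolding H1 K(1) by (simp add: G0)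
  show "ess_norm ((deriv ^^ (k + 2)) (green_sol p q r))
      \<le> ereal (2 * (p * q / (p + q))) * ess_norm ((deriv ^^ (k + 1)) r)"
    using lipschitz_ess_norm_deriv_le[OF lip(2)] G1 unfolding H1 K(1) by (simp add: eval_nat_numeral)
  show "ess_norm ((deriv ^^ (k + 3)) (green_sol p q r))
      \<le> ereal (2 * p * q) * ess_norm ((deriv ^^ (k + 1)) r)"
    using lipschitz_ess_norm_deriv_le[OF lip(3)] G2 unfolding H1 K(1) by (simp add: eval_nat_numeral)
qed

section \<open>The asymmetric Laplace distribution\<close>

text \<open>The density of the asymmetric Laplace distribution up to normalisation, written in terms of the two rates.\<close>

definition laplace_weight :: "real \<Rightarrow> real \<Rightarrow> real \<Rightarrow> real" where
  "laplace_weight p q t = (if t \<ge> 0 then exp (- p * t) else exp (q * t))"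

text \<open>On \<open>{x..}\<close> the one-sided weight \<open>exp (- p t)\<close> is at most a constant multiple of the two-sided one: they differ only
on the part to the left of \<open>0\<close>, which is bounded.\<close>

lemma laplace_weight_exp_integrable_right:
  assumes "p > 0" "q > 0" and [measurable]: "g \<in> borel_measurable borel"
    and int: "integrable lborel (\<lambda>t. laplace_weight p q t * g t)"
  shows "exp_integrable_right p g"
  unfolding exp_integrable_right_def
proof
  fix x :: real
  let ?E = "exp ((p + q) * \<bar>x\<bar>)"
  have "integrable lborel (\<lambda>t. ?E * (laplace_weight p q t * g t))" using int by simp
  then show "set_integrable lborel {x..} (\<lambda>t. exp (- p * t) * g t)"
    unfolding set_integrable_def
  proof (rule Bochner_Integration.integrable_bound)
    show "AE t in lborel. norm (indicator {x..} t *\<^sub>R (exp (- p * t) * g t))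
        \<le> norm (?E * (laplace_weight p q t * g t))"
    proof (rule AE_I2)
      fix t
      have "exp (- p * t) \<le> ?E * laplace_weight p q t" if "x \<le> t"
      proof (cases "t \<ge> 0")
        case True
        then show ?thesis using assms(1,2) by (simp add: laplace_weight_def)
      next
        case False
        then have "(p + q) * (- t) \<le> (p + q) * \<bar>x\<bar>" using that assms(1,2) by (intro mult_left_mono) auto
        then have "- p * t \<le> (p + q) * \<bar>x\<bar> + q * t" by (simp add: algebra_simps)
        then have "exp (- p * t) \<le> exp ((p + q) * \<bar>x\<bar> + q * t)" by simp
        then show ?thesis using False by (simp only: laplace_weight_def exp_add if_False)
      qed
      then have "exp (- p * t) * \<bar>g t\<bar> \<le> ?E * laplace_weight p q t * \<bar>g t\<bar>" if "x \<le> t"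
        using that by (intro mult_right_mono) auto
      moreover have "laplace_weight p q t \<ge> 0" by (simp add: laplace_weight_def)
      ultimately show "norm (indicator {x..} t *\<^sub>R (exp (- p * t) * g t))
          \<le> norm (?E * (laplace_weight p q t * g t))"
        by (cases "x \<le> t") (auto simp: abs_mult mult.assoc)
    qed
  qed measurable
qed

lemma laplace_weight_exp_integrable_left:
  assumes "p > 0" "q > 0" and [measurable]: "g \<in> borel_measurable borel"
    and int: "integrable lborel (\<lambda>t. laplace_weight p q t * g t)"
  shows "exp_integrable_left q g"
  unfolding exp_integrable_left_reflect
proof (rule laplace_weight_exp_integrable_right[of q p])
  have eq: "laplace_weight q p t * g (- t) = laplace_weight p q (0 + (-1) * t) * g (0 + (-1) * t)" for t
    by (auto simp: laplace_weight_def)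
  show "integrable lborel (\<lambda>t. laplace_weight q p t * g (- t))"
    unfolding eq using int by (subst lborel_integrable_real_affine_iff) auto
qed (use assms in auto)

text \<open>At the origin the two one-sided weights fit together to the density, so the value is a multiple of the mean.\<close>

lemma green_sol_zero:
  assumes r: "exp_integrable_right p r" "exp_integrable_left q r"
    and zero: "(\<integral>t. laplace_weight p q t * r t \<partial>lborel) = 0"
  shows "green_sol p q r 0 = 0"
proof -
  have "set_integrable lborel {0..} (\<lambda>t. laplace_weight p q t * r t) \<longleftrightarrow>
      set_integrable lborel {0..} (\<lambda>t. exp (- p * t) * r t)"
    by (rule set_integrable_cong) (auto simp: laplace_weight_def)
  then have right: "set_integrable lborel {0..} (\<lambda>t. laplace_weight p q t * r t)"
    using r(1) unfolding exp_integrable_right_def by blast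
  have "set_integrable lborel {..<0} (\<lambda>t. laplace_weight p q t * r t) \<longleftrightarrow>
      set_integrable lborel {..<0} (\<lambda>t. exp (q * t) * r t)"
    by (rule set_integrable_cong) (auto simp: laplace_weight_def)
  moreover have "set_integrable lborel {..<0} (\<lambda>t. exp (q * t) * r t)"
    by (rule set_integrable_subset[OF r(2)[unfolded exp_integrable_left_def, rule_format, of 0]]) auto
  ultimately have left: "set_integrable lborel {..<0} (\<lambda>t. laplace_weight p q t * r t)" by blast
  have "0 = (LBINT t:{..<0} \<union> {0..}. laplace_weight p q t * r t)"
  proof -
    have U: "{..<0} \<union> {0..} = (UNIV :: real set)" by auto
    show ?thesis unfolding U set_lebesgue_integral_def using zero by simp
  qed
  also have "\<dots> = (LBINT t:{..<0}. laplace_weight p q t * r t) + (LBINT t:{0..}. laplace_weight p q t * r t)"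
    by (rule set_integral_Un[OF _ left right]) auto
  also have "(LBINT t:{..<0}. laplace_weight p q t * r t) = (LBINT t:{..<0}. exp (q * t) * r t)"
    by (rule set_lebesgue_integral_cong) (auto simp: laplace_weight_def)
  also have "\<dots> = (LBINT t:{..0}. exp (q * t) * r t)"
    by (rule set_integral_discrete_difference[where X = "{0}"]) auto
  also have "(LBINT t:{0..}. laplace_weight p q t * r t) = (LBINT t:{0..}. exp (- p * t) * r t)"
    by (rule set_lebesgue_integral_cong) (auto simp: laplace_weight_def)
  finally show ?thesis by (simp add: green_sol_def resolvent_right_def resolvent_left_def)
qed

context
  fixes a b :: real
  assumes b: "b > 0"
begin

lemma rate_eqs:
  shows "rate_pos a b = (sqrt (2 * b\<^sup>2 + a\<^sup>2) - a) / b\<^sup>2"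
    and "rate_neg a b = (sqrt (2 * b\<^sup>2 + a\<^sup>2) + a) / b\<^sup>2"
    and "1 / b * sqrt (2 + a\<^sup>2 / b\<^sup>2) = sqrt (2 * b\<^sup>2 + a\<^sup>2) / b\<^sup>2"
proof -
  have "2 + a\<^sup>2 / b\<^sup>2 = (2 * b\<^sup>2 + a\<^sup>2) / b\<^sup>2" using b by (simp add: field_simps)
  then have *: "sqrt (2 + a\<^sup>2 / b\<^sup>2) = sqrt (2 * b\<^sup>2 + a\<^sup>2) / b" using b by (simp add: real_sqrt_divide)
  show "rate_pos a b = (sqrt (2 * b\<^sup>2 + a\<^sup>2) - a) / b\<^sup>2"
    and "rate_neg a b = (sqrt (2 * b\<^sup>2 + a\<^sup>2) + a) / b\<^sup>2"
    and "1 / b * sqrt (2 + a\<^sup>2 / b\<^sup>2) = sqrt (2 * b\<^sup>2 + a\<^sup>2) / b\<^sup>2"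
    unfolding rate_pos_def rate_neg_def * using b by (simp_all add: power2_eq_square field_simps)
qed

lemma rate_props:
  shows "rate_pos a b > 0" "rate_neg a b > 0"
    and "rate_pos a b * rate_neg a b = 2 / b\<^sup>2"
    and "rate_neg a b - rate_pos a b = 2 * a / b\<^sup>2"
    and "rate_pos a b * rate_neg a b / (rate_pos a b + rate_neg a b) = 1 / sqrt (2 * b\<^sup>2 + a\<^sup>2)"
proof -
  define s where "s = sqrt (2 * b\<^sup>2 + a\<^sup>2)"
  have s2: "s\<^sup>2 = 2 * b\<^sup>2 + a\<^sup>2" by (simp add: s_def)
  have "\<bar>a\<bar> < s" unfolding s_def using b by (intro real_less_rsqrt) auto
  then show "rate_pos a b > 0" "rate_neg a b > 0"
    unfolding rate_eqs s_def[symmetric] using b by auto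
  have s: "s > 0" using \<open>\<bar>a\<bar> < s\<close> by auto
  have "(s - a) * (s + a) = 2 * b\<^sup>2" using s2 by (simp add: algebra_simps power2_eq_square)
  then show pq: "rate_pos a b * rate_neg a b = 2 / b\<^sup>2"
    unfolding rate_eqs s_def[symmetric] using b by (simp add: power2_eq_square)
  show "rate_neg a b - rate_pos a b = 2 * a / b\<^sup>2"
    unfolding rate_eqs by (simp add: diff_divide_distrib[symmetric])
  have "rate_pos a b + rate_neg a b = 2 * s / b\<^sup>2"
    unfolding rate_eqs s_def[symmetric] by (simp add: add_divide_distrib[symmetric])
  then show "rate_pos a b * rate_neg a b / (rate_pos a b + rate_neg a b) = 1 / sqrt (2 * b\<^sup>2 + a\<^sup>2)"
    unfolding pq s_def[symmetric] using b s by simp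
qed

lemma AL_density_eq:
  "AL_density a b x = 1 / sqrt (2 * b\<^sup>2 + a\<^sup>2) * laplace_weight (rate_pos a b) (rate_neg a b) x"
proof -
  have "a / b\<^sup>2 * x - sqrt (2 * b\<^sup>2 + a\<^sup>2) / b\<^sup>2 * \<bar>x\<bar> =
      (if x \<ge> 0 then - rate_pos a b * x else rate_neg a b * x)"
    unfolding rate_eqs by (simp add: algebra_simps add_divide_distrib diff_divide_distrib)
  then show ?thesis
    unfolding AL_density_def rate_eqs(3) laplace_weight_def by simp
qed

lemma stein_sol_eq_green_sol: "stein_sol a b r = green_sol (rate_pos a b) (rate_neg a b) r"
  unfolding stein_sol_def green_sol_def resolvent_right_def resolvent_left_def rate_props(5) by (rule ext) simp

text \<open>Transfers \<open>E r(Z) = 0\<close> and integrability of \<open>r(Z)\<close> to Lebesgue integrals against the density.\<close>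

lemma AL_distributed_centred:
  assumes "prob_space M" and Z: "AL_distributed M Z a b" and h: "h \<in> borel_measurable borel"
    and int: "integrable M (\<lambda>\<omega>. h (Z \<omega>))"
  defines "r \<equiv> \<lambda>x. h x - (LINT \<omega>|M. h (Z \<omega>))"
  shows "integrable lborel (\<lambda>t. laplace_weight (rate_pos a b) (rate_neg a b) t * r t)"
    and "(\<integral>t. laplace_weight (rate_pos a b) (rate_neg a b) t * r t \<partial>lborel) = 0"
proof -
  interpret prob_space M by fact
  have D: "distributed M lborel Z (\<lambda>x. ennreal (AL_density a b x))" using Z by (simp add: AL_distributed_def)
  have nn: "0 \<le> AL_density a b x" for x by (simp add: AL_density_def)
  have r: "r \<in> borel_measurable lborel" using h by (simp add: r_def)
  have "integrable M (\<lambda>\<omega>. r (Z \<omega>))" "(\<integral>\<omega>. r (Z \<omega>) \<partial>M) = 0"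
    using int by (auto simp: r_def prob_space)
  then have *: "integrable lborel (\<lambda>x. AL_density a b x * r x)" "(\<integral>x. AL_density a b x * r x \<partial>lborel) = 0"
    using distributed_integrable[OF D r nn] distributed_integral[OF D r nn] by auto
  have s: "sqrt (2 * b\<^sup>2 + a\<^sup>2) > 0" using b by (simp add: add_pos_nonneg)
  have eq: "laplace_weight (rate_pos a b) (rate_neg a b) t * r t = sqrt (2 * b\<^sup>2 + a\<^sup>2) * (AL_density a b t * r t)" for t
    using s by (simp add: AL_density_eq)
  show "integrable lborel (\<lambda>t. laplace_weight (rate_pos a b) (rate_neg a b) t * r t)"
    and "(\<integral>t. laplace_weight (rate_pos a b) (rate_neg a b) t * r t \<partial>lborel) = 0"
    unfolding eq using * by auto
qed

lemma stein_equation_iff: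
  "b\<^sup>2 / 2 * y'' + a * y' - y = z \<longleftrightarrow>
    y'' + (rate_neg a b - rate_pos a b) * y' - rate_pos a b * rate_neg a b * y = rate_pos a b * rate_neg a b * z"
proof -
  have "y'' + (rate_neg a b - rate_pos a b) * y' - rate_pos a b * rate_neg a b * y =
      2 / b\<^sup>2 * (b\<^sup>2 / 2 * y'' + a * y' - y)"
    unfolding rate_props using b by (simp add: field_simps)
  moreover have "2 / b\<^sup>2 \<noteq> 0" using b by simp
  ultimately show ?thesis unfolding rate_props(3) by (simp only: mult_cancel_left) simp
qed

end

section \<open>Solution and regularity bounds for the Stein equation\<close>

text \<open>The existence statement, with a constant that depends on the order, lets continuity, differentiability and
Lipschitz properties pass between \<open>h\<close> and its centred version uniformly in the order, order zero included.\<close>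

lemma iterated_deriv_diff_const:
  fixes h :: "real \<Rightarrow> real"
  shows "\<exists>d. \<forall>x. (deriv ^^ j) (\<lambda>x. h x - c) x = (deriv ^^ j) h x - d"
    and "(deriv ^^ (j + 1)) (\<lambda>x. h x - c) = (deriv ^^ (j + 1)) h"
proof -
  have "((\<lambda>x. h x - c) has_real_derivative D) (at x) \<longleftrightarrow> (h has_real_derivative D) (at x)" for D x
    using DERIV_diff[OF _ DERIV_const, of h D x UNIV c] DERIV_add[OF _ DERIV_const, of "\<lambda>x. h x - c" D x UNIV c]
    by auto
  then have "deriv (\<lambda>x. h x - c) = deriv h" unfolding deriv_def by simp
  then have *: "(deriv ^^ (Suc i)) (\<lambda>x. h x - c) = (deriv ^^ (Suc i)) h" for i
    by (simp only: funpow_Suc_right comp_apply)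
  then show "(deriv ^^ (j + 1)) (\<lambda>x. h x - c) = (deriv ^^ (j + 1)) h" by simp
  show "\<exists>d. \<forall>x. (deriv ^^ j) (\<lambda>x. h x - c) x = (deriv ^^ j) h x - d"
  proof (cases j)
    case 0 then show ?thesis by auto
  next
    case (Suc i) then show ?thesis using * by (auto intro!: exI[of _ 0])
  qed
qed

theorem lemma2p2:
  fixes a b :: real and M :: "'s measure" and Z :: "'s \<Rightarrow> real"
    and h h_tilde f_h :: "real \<Rightarrow> real"
  assumes "b > 0"
    and "prob_space M"
    and "AL_distributed M Z a b"
    and "h \<in> borel_measurable borel"
    and "integrable M (\<lambda>\<omega>. h (Z \<omega>))"
    and h_tilde: "h_tilde = (\<lambda>x. h x - (LINT \<omega>|M. h (Z \<omega>)))"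
    and f_h: "f_h = stein_sol a b h_tilde"
  shows
    "(\<forall>x. set_integrable lborel {x..} (\<lambda>t. exp (- rate_pos a b * t) * h_tilde t) \<and>
          set_integrable lborel {..x} (\<lambda>t. exp (rate_neg a b * t) * h_tilde t)) \<and>
     stein_ivp_solution a b h_tilde f_h \<and>
     (bounded (range h) \<longrightarrow>
        bounded (range f_h) \<and>
        (\<forall>f. stein_ivp_solution a b h_tilde f \<and> bounded (range f) \<longrightarrow> f = f_h) \<and>
        ess_norm f_h \<le> ess_norm h_tilde \<and>
        ess_norm (deriv f_h) \<le> ereal (2 / sqrt (2 * b\<^sup>2 + a\<^sup>2)) * ess_norm h_tilde \<and>
        ess_norm (deriv (deriv f_h)) \<le> ereal (4 / b\<^sup>2) * ess_norm h_tilde) \<and>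
     (\<forall>k::nat.
        (\<forall>j<k. \<forall>x. (deriv ^^ j) h differentiable (at x)) \<and>
        (\<exists>L. L-lipschitz_on UNIV ((deriv ^^ k) h)) \<longrightarrow>
        (\<forall>j\<le>k + 1. \<forall>x. (deriv ^^ j) f_h differentiable (at x)) \<and>
        (AE x in lebesgue. (deriv ^^ (k + 2)) f_h differentiable (at x)) \<and>
        ess_norm ((deriv ^^ (k + 1)) f_h) \<le> ess_norm ((deriv ^^ (k + 1)) h) \<and>
        ess_norm ((deriv ^^ (k + 2)) f_h)
          \<le> ereal (2 / sqrt (2 * b\<^sup>2 + a\<^sup>2)) * ess_norm ((deriv ^^ (k + 1)) h) \<and>
        ess_norm ((deriv ^^ (k + 3)) f_h)
          \<le> ereal (4 / b\<^sup>2) * ess_norm ((deriv ^^ (k + 1)) h))"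
proof -
  note b = \<open>b > 0\<close>
  define p where "p = rate_pos a b"
  define q where "q = rate_neg a b"
  note rates = rate_props[OF b, of a, folded p_def q_def]
  note p = rates(1) and q = rates(2)
  have slope_const: "2 / sqrt (2 * b\<^sup>2 + a\<^sup>2) = 2 * (p * q / (p + q))" unfolding rates(5) by simp
  have curv_const: "4 / b\<^sup>2 = 2 * p * q" using rates(3) by (simp add: mult.assoc)
  have ode_iff: "b\<^sup>2 / 2 * y'' + a * y' - y = z \<longleftrightarrow> y'' + (q - p) * y' - p * q * y = p * q * z" for y y' y'' z
    unfolding p_def q_def by (rule stein_equation_iff[OF b])
  have meas [measurable]: "h_tilde \<in> borel_measurable borel" using assms(4) by (simp add: h_tilde)
  have weight: "integrable lborel (\<lambda>t. laplace_weight p q t * h_tilde t)"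
      "(\<integral>t. laplace_weight p q t * h_tilde t \<partial>lborel) = 0"
    unfolding h_tilde p_def q_def by (rule AL_distributed_centred[OF b assms(2-5)])+
  have int: "exp_integrable_right p h_tilde" "exp_integrable_left q h_tilde"
    using laplace_weight_exp_integrable_right[OF p q meas weight(1)]
      laplace_weight_exp_integrable_left[OF p q meas weight(1)] by auto
  have f: "f_h = green_sol p q h_tilde"
    unfolding f_h p_def q_def by (rule stein_sol_eq_green_sol[OF b])
  have f': "deriv f_h = green_slope p q h_tilde" unfolding f by (rule deriv_green_sol[OF p q int])
  note curv = green_slope_AE_derivative[OF p q int, folded f']
  have diff: "f_h differentiable (at x)" for x
    using green_sol_derivative[OF p q int, of x] unfolding f real_differentiable_def by blast
  have ac: "loc_abs_cont f_h" "loc_abs_cont (deriv f_h)"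
    unfolding f' using green_sol_loc_abs_cont[OF p q int] green_slope_loc_abs_cont[OF p q int] by (auto simp: f)
  have ode: "green_curv p q h_tilde x + (q - p) * deriv f_h x - p * q * f_h x = p * q * h_tilde x" for x
    unfolding f' unfolding f by (rule green_ode)
  have sol: "stein_ivp_solution a b h_tilde f_h"
    unfolding stein_ivp_solution_def
  proof (intro conjI allI)
    show "AE x in lebesgue. deriv f_h differentiable (at x) \<and>
        b\<^sup>2 / 2 * deriv (deriv f_h) x + a * deriv f_h x - f_h x = h_tilde x"
      using curv
    proof eventually_elim
      case (elim x)
      then show ?case
        unfolding ode_iff DERIV_imp_deriv[OF elim] using ode real_differentiable_def by blast
    qed
    show "f_h 0 = 0" unfolding f by (rule green_sol_zero[OF int weight(2)])
  qed (use diff ac in auto)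
  have bounded_case: "bounded (range f_h) \<and>
        (\<forall>f. stein_ivp_solution a b h_tilde f \<and> bounded (range f) \<longrightarrow> f = f_h) \<and>
        ess_norm f_h \<le> ess_norm h_tilde \<and>
        ess_norm (deriv f_h) \<le> ereal (2 / sqrt (2 * b\<^sup>2 + a\<^sup>2)) * ess_norm h_tilde \<and>
        ess_norm (deriv (deriv f_h)) \<le> ereal (4 / b\<^sup>2) * ess_norm h_tilde"
    if bdd_h: "bounded (range h)"
  proof -
    obtain B where "\<And>x. \<bar>h x\<bar> \<le> B" using bdd_h unfolding bounded_iff by auto
    then have "\<bar>h_tilde x\<bar> \<le> B + \<bar>LINT \<omega>|M. h (Z \<omega>)\<bar>" for x
      unfolding h_tilde using abs_triangle_ineq4[of "h x"] by (meson add_right_mono order_trans)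
    then have ae: "AE x in lebesgue. \<bar>h_tilde x\<bar> \<le> B + \<bar>LINT \<omega>|M. h (Z \<omega>)\<bar>" by simp
    have meas': "h_tilde \<in> borel_measurable lebesgue" by (rule measurable_completion) simp
    obtain K where "K \<ge> 0" and K: "ess_norm h_tilde = ereal K" "AE x in lebesgue. \<bar>h_tilde x\<bar> \<le> K"
      by (rule ess_norm_finite[OF meas' ae])
    have K': "AE x in lborel. \<bar>h_tilde x\<bar> \<le> K" using K(2) by (simp add: AE_completion_iff)
    note bounds = green_bounds[OF p q int K']
    have bdd: "bounded (range f_h)" unfolding f bounded_iff using bounds(1) by auto
    have solD: "AE x in lebesgue. (deriv g has_real_derivative p * q * h_tilde x + p * q * g x - (q - p) * deriv g x) (at x)"
      if "stein_ivp_solution a b h_tilde g" for g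
    proof -
      have "AE x in lebesgue. deriv g differentiable (at x) \<and>
          b\<^sup>2 / 2 * deriv (deriv g) x + a * deriv g x - g x = h_tilde x"
        using that by (simp add: stein_ivp_solution_def)
      then show ?thesis
      proof eventually_elim
        case (elim x)
        then have "deriv (deriv g) x = p * q * h_tilde x + p * q * g x - (q - p) * deriv g x"
          unfolding ode_iff by linarith
        with elim show ?case by (simp add: DERIV_deriv_iff_real_differentiable[symmetric])
      qed
    qed
    have solC1: "g differentiable (at x)" "loc_abs_cont (deriv g)" if "stein_ivp_solution a b h_tilde g" for g x
      using that unfolding stein_ivp_solution_def by blast+
    have unique: "g = f_h" if "stein_ivp_solution a b h_tilde g" "bounded (range g)" for g
      using solC1[OF that(1)] solD[OF that(1)] that(2) solC1[OF sol] solD[OF sol] bdd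
      by (rule bounded_solution_unique[OF p q])
    have "ess_norm f_h \<le> ereal K"
      unfolding f
    proof (rule ess_norm_le)
      show "green_sol p q h_tilde \<in> borel_measurable lebesgue"
        using loc_abs_cont_continuous[OF ac(1)] by (intro measurable_completion) (simp add: f borel_measurable_continuous_onI)
    qed (use bounds(1) in auto)
    moreover have "ess_norm (deriv f_h) \<le> ereal (2 / sqrt (2 * b\<^sup>2 + a\<^sup>2) * K)"
      unfolding f' slope_const
    proof (rule ess_norm_le)
      show "green_slope p q h_tilde \<in> borel_measurable lebesgue"
        using loc_abs_cont_continuous[OF ac(2)] by (intro measurable_completion) (simp add: f' borel_measurable_continuous_onI)
    qed (use bounds(2) in auto)
    moreover have "ess_norm (deriv (deriv f_h)) \<le> ereal (4 / b\<^sup>2 * K)"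
      unfolding curv_const
    proof (rule ess_norm_le)
      have d2: "AE x in lebesgue. deriv (deriv f_h) x = green_curv p q h_tilde x"
        using curv by eventually_elim (rule DERIV_imp_deriv)
      have [measurable]: "resolvent_right p h_tilde \<in> borel_measurable borel" "resolvent_left q h_tilde \<in> borel_measurable borel"
        by (intro borel_measurable_continuous_onI loc_abs_cont_continuous resolvent_right_loc_abs_cont
            resolvent_left_loc_abs_cont int)+
      have "green_curv p q h_tilde \<in> borel_measurable borel" unfolding green_curv_def[abs_def] by measurable
      then show "deriv (deriv f_h) \<in> borel_measurable lebesgue" using d2 by (rule borel_measurable_lebesgue_AE_eq)
      show "AE x in lebesgue. \<bar>deriv (deriv f_h) x\<bar> \<le> 2 * p * q * K"
        using d2 K(2)
      proof eventually_elim
        case (elim x)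
        have "p * q * \<bar>h_tilde x\<bar> \<le> p * q * K" using elim p q by (intro mult_left_mono) auto
        then show ?case using bounds(3)[of x] elim by simp
      qed
    qed
    ultimately show ?thesis using bdd unique K(1) by auto
  qed
  have lipschitz_case: "(\<forall>j\<le>k + 1. \<forall>x. (deriv ^^ j) f_h differentiable (at x)) \<and>
        (AE x in lebesgue. (deriv ^^ (k + 2)) f_h differentiable (at x)) \<and>
        ess_norm ((deriv ^^ (k + 1)) f_h) \<le> ess_norm ((deriv ^^ (k + 1)) h) \<and>
        ess_norm ((deriv ^^ (k + 2)) f_h)
          \<le> ereal (2 / sqrt (2 * b\<^sup>2 + a\<^sup>2)) * ess_norm ((deriv ^^ (k + 1)) h) \<and>
        ess_norm ((deriv ^^ (k + 3)) f_h)
          \<le> ereal (4 / b\<^sup>2) * ess_norm ((deriv ^^ (k + 1)) h)"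
    if k: "\<And>j x. j < k \<Longrightarrow> (deriv ^^ j) h differentiable (at x)" and L: "L-lipschitz_on UNIV ((deriv ^^ k) h)"
    for k L
  proof -
    have shift: "\<exists>d. (deriv ^^ j) h_tilde = (\<lambda>x. (deriv ^^ j) h x - d)" for j
      using iterated_deriv_diff_const(1)[of j h "LINT \<omega>|M. h (Z \<omega>)"] unfolding h_tilde by (auto simp: fun_eq_iff)
    have k': "(deriv ^^ j) h_tilde differentiable (at x)" if "j < k" for j x
    proof -
      obtain d where "(deriv ^^ j) h_tilde = (\<lambda>x. (deriv ^^ j) h x - d)" using shift by blast
      then show ?thesis using k[OF that, of x] by simp
    qed
    have L': "L-lipschitz_on UNIV ((deriv ^^ k) h_tilde)"
    proof -
      obtain d where "(deriv ^^ k) h_tilde = (\<lambda>x. (deriv ^^ k) h x - d)" using shift by blast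
      then show ?thesis using L by (simp add: lipschitz_on_def dist_real_def)
    qed
    have eq: "(deriv ^^ (k + 1)) h_tilde = (deriv ^^ (k + 1)) h"
      unfolding h_tilde by (rule iterated_deriv_diff_const(2))
    show ?thesis
      using green_sol_lipschitz_derivatives[OF p q k' L', unfolded eq, folded f slope_const curv_const] by blast
  qed
  show ?thesis
    using int[unfolded exp_integrable_right_def exp_integrable_left_def p_def q_def] sol bounded_case lipschitz_case
    by blast
qed

end
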